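(* Let $p$ be a prime and let $\lambda_1\geq\lambda_2\geq\lambda_3\geq 1$ be integers. Then \begin{align*} F_2(\mathbb{Z}_{p^{\lambda_1}}\times\mathbb{Z}_{p^{\lambda_2}}\times\mathbb{Z}_{p^{\lambda_3}})={}&-p^3 f(\lambda_1-1,\lambda_2-1,\lambda_3-1)^2\\ &+p\Big(f(\lambda_1-1,\lambda_2-1,\lambda_3)^2+p\,f(\lambda_1-1,\lambda_2,\lambda_3-1)^2+p^2 f(\lambda_1,\lambda_2-1,\lambda_3-1)^2\Big)\\ &-\Big(f(\lambda_1-1,\lambda_2,\lambda_3)^2+p\,f(\lambda_1,\lambda_2-1,\lambda_3)^2+p^2 f(\lambda_1,\lambda_2,\lambda_3-1)^2\Big)\\ &+f(\lambda_1,\lambda_2,\lambda_3)^2, \end{align*} where $F_2$ is the factorization number and $f$ is the explicit expression given in the context.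
   Context: For a finite group $G$, a factorization of $G$ is an expression $G=HK$ with $H,K$ subgroups of $G$. The factorization number $F_2(G)$ is the number of all factorizations of $G$, i.e. the number of ordered pairs $(H,K)$ of subgroups of $G$ with $G=HK$. $\mathbb{Z}_n$ denotes the cyclic group of order $n$. For a prime $p$ and nonnegative integers $\lambda_1,\lambda_2,\lambda_3$ (the formula is used as written for any such arguments, in whatever order they appear), put $$f(\lambda_1,\lambda_2,\lambda_3)=\frac{A}{(p^2-1)^2(p-1)},$$ where \begin{align*} A={}&(\lambda_3+1)(\lambda_1-\lambda_2+1)p^{\lambda_2+\lambda_3+5}+2(\lambda_3+1)p^{\lambda_2+\lambda_3+4}-2(\lambda_3+1)(\lambda_1-\lambda_2)p^{\lambda_2+\lambda_3+3}\\ &-2(\lambda_3+1)p^{\lambda_2+\lambda_3+2}+(\lambda_3+1)(\lambda_1-\lambda_2-1)p^{\lambda_2+\lambda_3+1}-(\lambda_1+\lambda_2-\lambda_3+3)p^{2\lambda_3+4}\\ &-2p^{2\lambda_3+3}+(\lambda_1+\lambda_2-\lambda_3-1)p^{2\lambda_3+2}+(\lambda_1+\lambda_2+\lambda_3+5)p^2+2p-(\lambda_1+\lambda_2+\lambda_3+1). \end{align*} *)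

theory Defs
  imports Complex_Main "HOL-Algebra.Elementary_Groups" "HOL-Computational_Algebra.Primes"
begin

definition factorizations :: "('a, 'b) monoid_scheme \<Rightarrow> ('a set \<times> 'a set) set" where
  "factorizations G =
     {(H, K). subgroup H G \<and> subgroup K G \<and> carrier G = H <#>\<^bsub>G\<^esub> K}"

definition factorization_number :: "('a, 'b) monoid_scheme \<Rightarrow> nat" where
  "factorization_number G = card (factorizations G)"

text \<open>The coefficients below are formed in the reals: differences such as
  \<open>real l1 - real l2\<close> can be negative, since the arguments need not be
  ordered. The exponents only involve addition and multiplication.\<close>

definition f_numerator :: "nat \<Rightarrow> nat \<Rightarrow> nat \<Rightarrow> nat \<Rightarrow> real" where
  "f_numerator p l1 l2 l3 =
     (real l3 + 1) * (real l1 - real l2 + 1) * real p ^ (l2 + l3 + 5)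
     + 2 * (real l3 + 1) * real p ^ (l2 + l3 + 4)
     - 2 * (real l3 + 1) * (real l1 - real l2) * real p ^ (l2 + l3 + 3)
     - 2 * (real l3 + 1) * real p ^ (l2 + l3 + 2)
     + (real l3 + 1) * (real l1 - real l2 - 1) * real p ^ (l2 + l3 + 1)
     - (real l1 + real l2 - real l3 + 3) * real p ^ (2 * l3 + 4)
     - 2 * real p ^ (2 * l3 + 3)
     + (real l1 + real l2 - real l3 - 1) * real p ^ (2 * l3 + 2)
     + (real l1 + real l2 + real l3 + 5) * real p ^ 2
     + 2 * real p
     - (real l1 + real l2 + real l3 + 1)"

definition f_expr :: "nat \<Rightarrow> nat \<Rightarrow> nat \<Rightarrow> nat \<Rightarrow> real" where
  "f_expr p l1 l2 l3 = f_numerator p l1 l2 l3 / ((real p ^ 2 - 1) ^ 2 * (real p - 1))"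

end

theory Submission
  imports Defs "HOL-Library.Product_Plus"
begin

text \<open>Subgroups of \<open>\<int>/p\<^bsup>a\<^esup> \<times> \<int>/p\<^bsup>b\<^esup> \<times> \<int>/p\<^bsup>c\<^esup>\<close> are the lattices \<open>L \<subseteq> \<int>\<^sup>3\<close> that contain
  \<open>\<Lambda> = p\<^bsup>a\<^esup>\<int> \<times> p\<^bsup>b\<^esup>\<int> \<times> p\<^bsup>c\<^esup>\<int>\<close>, and factorizations are the pairs of such lattices with sum
  \<open>\<int>\<^sup>3\<close>. Moebius inversion over the lattices between \<open>p\<int>\<^sup>3\<close> and \<open>\<int>\<^sup>3\<close> reduces the
  count of these pairs to the number of sublattices of each intermediate lattice, and a triangular change
  of coordinates turns every intermediate lattice into a rescaled \<open>\<int>\<^sup>3\<close>.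

  To count the lattices \<open>L \<supseteq> \<Lambda>\<close>, put \<open>S\<^sub>k(a, b, c) = \<Sum>\<^sub>L [L : \<Lambda>]\<^sup>k\<close> and let \<open>a > 0\<close> be the
  largest exponent. The lattices containing \<open>p\<^bsup>a-1\<^esup>e\<^sub>1\<close> contribute \<open>p\<^sup>k S\<^sub>k(a-1, b, c)\<close>. The
  others are the graphs of homomorphisms to \<open>\<int>/p\<^bsup>a\<^esup>\<close> from subgroups of the remaining factors; a
  subgroup of order \<open>m\<close> has exactly \<open>m\<close> such homomorphisms, since \<open>a\<close> is maximal, which gives
  \<open>S\<^sub>k\<^sub>+\<^sub>1(0, b, c)\<close>. Together with the symmetry of \<open>S\<^sub>k\<close> this recurrence determines
  \<open>S\<^sub>0 = f\<close>.\<close>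

section \<open>Overlattices and indices\<close>

definition residue_class :: "'a::ab_group_add set \<Rightarrow> 'a \<Rightarrow> 'a set" where
  "residue_class A x = {y. y - x \<in> A}"

text \<open>For A contained in L this is [L : A]. An infinite index is 0 by the convention of
  \<open>card\<close>; products of indices respect this convention.\<close>

definition lattice_index :: "'a::ab_group_add set \<Rightarrow> 'a set \<Rightarrow> nat" where
  "lattice_index A L = card (residue_class A ` L)"

text \<open>An abelian group viewed as a module over the integers, so that \<open>subspace\<close>
  and \<open>span\<close> mean subgroup and generated subgroup.\<close>

locale int_module = Modules.module scale
  for scale :: "int \<Rightarrow> 'b::ab_group_add \<Rightarrow> 'b" (infixr "*s" 75)
begin

lemma residue_class_eq_iff:
  assumes "subspace A"
  shows "residue_class A x = residue_class A y \<longleftrightarrow> x - y \<in> A"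
proof
  assume "residue_class A x = residue_class A y"
  moreover have "x \<in> residue_class A x"
    using assms by (simp add: residue_class_def subspace_0)
  ultimately show "x - y \<in> A"
    by (simp add: residue_class_def)
next
  assume *: "x - y \<in> A"
  have "z - x \<in> A \<longleftrightarrow> z - y \<in> A" for z
    using subspace_add[OF assms _ *, of "z - x"] subspace_diff[OF assms _ *, of "z - y"] by auto
  then show "residue_class A x = residue_class A y"
    by (simp add: residue_class_def)
qed

lemma transversal_obtain:
  obtains R where "R \<subseteq> L" "inj_on (residue_class A) R" "residue_class A ` L = residue_class A ` R"
proof -
  have "\<exists>U. U \<subseteq> L \<and> inj_on (residue_class A) U \<and> residue_class A ` L = residue_class A ` U"
    by (rule subset_image_inj[THEN iffD1, OF subset_refl])
  then show ?thesis
    by (elim exE conjE) (rule that)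
qed

lemma lattice_index_self:
  assumes "subspace A"
  shows "lattice_index A A = 1"
proof -
  have "residue_class A x = residue_class A 0" if "x \<in> A" for x
    using that assms by (simp add: residue_class_eq_iff)
  then have "residue_class A ` A = (\<lambda>_. residue_class A 0) ` A"
    by (rule image_cong[OF refl])
  also have "\<dots> = {residue_class A 0}"
    by (rule image_constant[OF subspace_0[OF assms]])
  finally have "residue_class A ` A = {residue_class A 0}" .
  then show ?thesis
    by (simp add: lattice_index_def)
qed

text \<open>If R represents B / A and S represents C / B, then each coset of A in C is met exactly
  once by the sums r + s.\<close>

lemma lattice_index_mult:
  assumes A: "subspace A" and B: "subspace B" and C: "subspace C" and AB: "A \<subseteq> B" and BC: "B \<subseteq> C"
  shows "lattice_index A C = lattice_index A B * lattice_index B C"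
proof -
  obtain R where R: "R \<subseteq> B" "inj_on (residue_class A) R" "residue_class A ` B = residue_class A ` R"
    by (rule transversal_obtain)
  obtain S where S: "S \<subseteq> C" "inj_on (residue_class B) S" "residue_class B ` C = residue_class B ` S"
    by (rule transversal_obtain)
  have "inj_on (\<lambda>(r, s). residue_class A (r + s)) (R \<times> S)"
  proof (rule inj_onI, clarify)
    fix r s r' s'
    assume rs: "r \<in> R" "s \<in> S" "r' \<in> R" "s' \<in> S" "residue_class A (r + s) = residue_class A (r' + s')"
    then have d: "(r - r') + (s - s') \<in> A"
      using residue_class_eq_iff[OF A] by (simp add: algebra_simps)
    moreover have "r - r' \<in> B"
      using rs R by (intro subspace_diff[OF B]) auto
    ultimately have "s - s' \<in> B"
      using subspace_diff[OF B, of "(r - r') + (s - s')" "r - r'"] AB by auto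
    then have "s = s'"
      using S rs by (auto simp: inj_on_def residue_class_eq_iff[OF B])
    with d have "r = r'"
      using R rs by (auto simp: inj_on_def residue_class_eq_iff[OF A])
    with \<open>s = s'\<close> show "r = r' \<and> s = s'" by simp
  qed
  moreover have "(\<lambda>(r, s). residue_class A (r + s)) ` (R \<times> S) = residue_class A ` C"
  proof
    show "(\<lambda>(r, s). residue_class A (r + s)) ` (R \<times> S) \<subseteq> residue_class A ` C"
    proof clarify
      fix r s assume "r \<in> R" "s \<in> S"
      then have "r + s \<in> C"
        using R S BC by (intro subspace_add[OF C]) auto
      then show "residue_class A (r + s) \<in> residue_class A ` C" by simp
    qed
    show "residue_class A ` C \<subseteq> (\<lambda>(r, s). residue_class A (r + s)) ` (R \<times> S)"
    proof clarify
      fix c assume "c \<in> C"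
      then obtain s where s: "s \<in> S" "residue_class B c = residue_class B s"
        using S by blast
      then have "c - s \<in> B"
        by (simp add: residue_class_eq_iff[OF B])
      then obtain r where r: "r \<in> R" "residue_class A (c - s) = residue_class A r"
        using R by blast
      then have "residue_class A c = residue_class A (r + s)"
        by (simp add: residue_class_eq_iff[OF A] algebra_simps)
      then show "residue_class A c \<in> (\<lambda>(r, s). residue_class A (r + s)) ` (R \<times> S)"
        using r s by auto
    qed
  qed
  ultimately have "lattice_index A C = card (R \<times> S)"
    unfolding lattice_index_def by (metis card_image)
  also have "\<dots> = lattice_index A B * lattice_index B C"
    unfolding lattice_index_def R(3) S(3) using R(2) S(2) by (simp add: card_cartesian_product card_image)
  finally show ?thesis .
qed

text \<open>Second isomorphism theorem: a transversal of L modulo the intersection is also a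
  transversal of Q = L + B modulo B.\<close>

lemma lattice_index_Int:
  assumes B: "subspace B" and L: "subspace L" and Q: "Q = {x + y |x y. x \<in> L \<and> y \<in> B}"
  shows "lattice_index (L \<inter> B) L = lattice_index B Q"
proof -
  have I: "subspace (L \<inter> B)"
    by (rule subspace_inter[OF L B])
  obtain R where R: "R \<subseteq> L" "inj_on (residue_class (L \<inter> B)) R" "residue_class (L \<inter> B) ` L = residue_class (L \<inter> B) ` R"
    by (rule transversal_obtain)
  have "inj_on (residue_class B) R"
  proof (rule inj_onI)
    fix x y assume xy: "x \<in> R" "y \<in> R" "residue_class B x = residue_class B y"
    then have "x \<in> L" "y \<in> L" "x - y \<in> B"
      using R by (auto simp: residue_class_eq_iff[OF B])
    then have "x - y \<in> L \<inter> B"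
      using subspace_diff[OF L] by blast
    then show "x = y"
      using R xy by (auto simp: inj_on_def residue_class_eq_iff[OF I])
  qed
  moreover have "residue_class B ` Q = residue_class B ` R"
  proof
    show "residue_class B ` Q \<subseteq> residue_class B ` R"
    proof clarify
      fix q assume "q \<in> Q"
      then obtain x y where xy: "q = x + y" "x \<in> L" "y \<in> B"
        using Q by auto
      then obtain r where r: "r \<in> R" "residue_class (L \<inter> B) x = residue_class (L \<inter> B) r"
        using R by blast
      then have "x - r \<in> B"
        by (simp add: residue_class_eq_iff[OF I])
      then have "residue_class B q = residue_class B r"
        using subspace_add[OF B _ xy(3), of "x - r"] xy by (simp add: residue_class_eq_iff[OF B] algebra_simps)
      with r show "residue_class B q \<in> residue_class B ` R" by simp
    qed
    show "residue_class B ` R \<subseteq> residue_class B ` Q"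
      using R Q subspace_0[OF B] by force
  qed
  ultimately show ?thesis
    unfolding lattice_index_def R(3) using R(2) by (simp add: card_image)
qed

definition overlattices :: "'b set \<Rightarrow> 'b set set" where
  "overlattices A = {L. subspace L \<and> A \<subseteq> L}"

text \<open>A lattice containing A is a union of cosets of A, hence determined by a subset of the
  finite quotient.\<close>

lemma finite_overlattices:
  assumes A: "subspace A" and fin: "finite (range (residue_class A))"
  shows "finite (overlattices A)"
proof (rule finite_imageD)
  show "finite ((`) (residue_class A) ` overlattices A)"
    by (rule finite_subset[OF _ finite_Pow_iff[THEN iffD2, OF fin]]) auto
  have "x \<in> L'" if "L' \<in> overlattices A" "residue_class A ` L = residue_class A ` L'" "x \<in> L" for L L' x
  proof -
    have "residue_class A x \<in> residue_class A ` L'"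
      using that(2,3) by (metis imageI)
    then obtain y where "y \<in> L'" "residue_class A x = residue_class A y"
      by auto
    then have "x - y \<in> L'" "y \<in> L'" "subspace L'"
      using that by (auto simp: overlattices_def residue_class_eq_iff[OF A])
    then show ?thesis
      using subspace_add[of L' "x - y" y] by auto
  qed
  then show "inj_on ((`) (residue_class A)) (overlattices A)"
    unfolding inj_on_def by (metis subsetI subset_antisym)
qed

lemma mem_span_insert_subspace:
  assumes "subspace B"
  shows "x \<in> span (insert g B) \<longleftrightarrow> (\<exists>k. x - k *s g \<in> B)"
  using assms by (simp add: span_breakdown_eq span_eq_iff[THEN iffD2])

text \<open>Puts L + <e> into the form L + B required by \<open>lattice_index_Int\<close>, where B
  is generated by e and A.\<close>

lemma span_insert_conv_sum:
  assumes L: "subspace L" and A: "subspace A" "A \<subseteq> L"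
  shows "span (insert e L) = {x + y |x y. x \<in> L \<and> y \<in> span (insert e A)}"
proof -
  have eA: "span (insert e A) \<subseteq> span (insert e L)"
    by (rule span_mono) (use A in auto)
  show ?thesis
  proof (intro equalityI subsetI)
    fix x assume "x \<in> span (insert e L)"
    then obtain k where "x - k *s e \<in> L"
      using mem_span_insert_subspace[OF L] by auto
    moreover have "k *s e \<in> span (insert e A)"
      by (intro span_scale span_base) auto
    ultimately show "x \<in> {x + y |x y. x \<in> L \<and> y \<in> span (insert e A)}"
      by (intro CollectI exI[of _ "x - k *s e"] exI[of _ "k *s e"]) auto
  next
    fix x assume "x \<in> {x + y |x y. x \<in> L \<and> y \<in> span (insert e A)}"
    then show "x \<in> span (insert e L)"
      using eA span_superset[of "insert e L"] by (auto intro!: span_add)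
  qed
qed

lemma finite_range_residue_class_mono:
  assumes A: "subspace A" and B: "subspace B" and AB: "A \<subseteq> B" and fin: "finite (range (residue_class A))"
  shows "finite (range (residue_class B))"
\<comment> \<open>The map sends a coset of A to the coset of B that contains it.\<close>
proof (rule finite_subset[OF _ finite_imageI[OF fin, of "\<lambda>X. {y. \<exists>x\<in>X. y - x \<in> B}"]], rule subsetI)
  fix Y assume "Y \<in> range (residue_class B)"
  then obtain x where x: "Y = residue_class B x" by auto
  have "y - x \<in> B \<longleftrightarrow> (\<exists>z. z - x \<in> A \<and> y - z \<in> B)" for y
  proof
    assume "y - x \<in> B"
    then show "\<exists>z. z - x \<in> A \<and> y - z \<in> B"
      using subspace_0[OF A] by (intro exI[of _ x]) simp
  next
    assume "\<exists>z. z - x \<in> A \<and> y - z \<in> B"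
    then obtain z where "z - x \<in> A" "y - z \<in> B" by auto
    then show "y - x \<in> B"
      using subspace_add[OF B, of "y - z" "z - x"] AB by auto
  qed
  then have "Y = (\<lambda>X. {y. \<exists>x\<in>X. y - x \<in> B}) (residue_class A x)"
    unfolding x by (auto simp: residue_class_def)
  then show "Y \<in> (\<lambda>X. {y. \<exists>x\<in>X. y - x \<in> B}) ` range (residue_class A)"
    by blast
qed

lemma bij_betw_image_overlattices:
  assumes T: "module_hom scale scale T" and inj: "inj T" and A: "A \<subseteq> K"
  shows "bij_betw ((`) T) {L \<in> overlattices A. L \<subseteq> K} {L \<in> overlattices (T ` A). L \<subseteq> T ` K}"
proof (rule bij_betwI[where g = "(-`) T"])
  show "(`) T \<in> {L \<in> overlattices A. L \<subseteq> K} \<rightarrow> {L \<in> overlattices (T ` A). L \<subseteq> T ` K}"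
    by (auto simp: overlattices_def intro: module_hom.subspace_image[OF T])
  have "L \<subseteq> T ` K \<Longrightarrow> T -` L \<subseteq> K" for L
    using inj by (auto simp: inj_def)
  then show "(-`) T \<in> {L \<in> overlattices (T ` A). L \<subseteq> T ` K} \<rightarrow> {L \<in> overlattices A. L \<subseteq> K}"
    by (auto simp: overlattices_def intro!: module_hom.subspace_vimage[OF T])
  show "T -` (T ` L) = L" for L
    using inj by (simp add: inj_vimage_image_eq)
  show "T ` (T -` L) = L" if "L \<in> {L \<in> overlattices (T ` A). L \<subseteq> T ` K}" for L
    using that by auto
qed

lemma lattice_index_image:
  assumes T: "module_hom scale scale T" and inj: "inj T"
  shows "lattice_index (T ` A) (T ` L) = lattice_index A L"
proof -
  have "residue_class (T ` A) (T x) = T ` residue_class A x" for x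
  proof (intro equalityI subsetI)
    fix y assume "y \<in> residue_class (T ` A) (T x)"
    then obtain a where a: "y - T x = T a" "a \<in> A"
      by (auto simp: residue_class_def)
    then have "y = T (a + x)"
      by (metis diff_add_cancel module_hom.add[OF T])
    moreover have "a + x \<in> residue_class A x"
      using a by (simp add: residue_class_def)
    ultimately show "y \<in> T ` residue_class A x" by blast
  qed (auto simp: residue_class_def simp flip: module_hom.diff[OF T])
  then have "residue_class (T ` A) ` (T ` L) = (`) T ` (residue_class A ` L)"
    by (simp add: image_image)
  moreover have "inj_on ((`) T) (residue_class A ` L)"
    using inj by (simp add: inj_on_def inj_image_eq_iff)
  ultimately show ?thesis
    by (simp add: lattice_index_def card_image)
qed

text \<open>Integer multiples are repeated sums and differences, so the subgroup criterion
  suffices.\<close>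

lemma subspaceI_diff:
  assumes "0 \<in> S" and diff: "\<And>x y. x \<in> S \<Longrightarrow> y \<in> S \<Longrightarrow> x - y \<in> S"
  shows "subspace S"
proof (rule subspaceI)
  have neg: "- x \<in> S" if "x \<in> S" for x
    using diff[OF \<open>0 \<in> S\<close> that] by simp
  show add: "x + y \<in> S" if "x \<in> S" "y \<in> S" for x y
    using diff[OF that(1) neg[OF that(2)]] by simp
  show "c *s x \<in> S" if x: "x \<in> S" for c x
  proof (induction c rule: int_induct[where k = 0])
    case base
    show ?case using assms(1) by simp
  next
    case (step1 i)
    then show ?case using add[OF _ x] by (simp add: scale_left_distrib)
  next
    case (step2 i)
    then show ?case using diff[OF _ x] by (simp add: scale_left_diff_distrib)
  qed
qed (rule assms(1))

end

section \<open>Steps of prime index between lattices\<close>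

locale prime_int_module = int_module scale
  for scale :: "int \<Rightarrow> 'b::ab_group_add \<Rightarrow> 'b" (infixr "*s" 75) +
  fixes p :: nat
  assumes prime_p: "Factorial_Ring.prime p"
begin

lemma prime_int_p: "Factorial_Ring.prime (int p)"
  using prime_p by simp

text \<open>The integers k that send g into B form an ideal that contains p but not 1; by Bezout it
  is generated by p.\<close>

lemma scale_mem_iff:
  assumes B: "subspace B" and g: "g \<notin> B" "int p *s g \<in> B"
  shows "k *s g \<in> B \<longleftrightarrow> int p dvd k"
proof
  assume "int p dvd k"
  then obtain m where "k = m * int p" by (metis dvd_def mult.commute)
  then show "k *s g \<in> B"
    using subspace_scale[OF B g(2), of m] by simp
next
  assume k: "k *s g \<in> B"
  show "int p dvd k"
  proof (rule ccontr)
    assume "\<not> int p dvd k"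
    then have "coprime (int p) k"
      using prime_int_p by (simp add: prime_imp_coprime)
    then obtain u v where uv: "u * int p + v * k = 1"
      by (metis bezout_int coprime_iff_gcd_eq_1)
    have "u *s (int p *s g) + v *s (k *s g) \<in> B"
      using subspace_add[OF B subspace_scale[OF B g(2)] subspace_scale[OF B k]] .
    then have "(u * int p + v * k) *s g \<in> B"
      by (simp only: scale_left_distrib scale_scale)
    then have "1 *s g \<in> B" by (simp only: uv)
    with g show False by simp
  qed
qed

lemma lattice_index_span_insert:
  assumes B: "subspace B" and g: "g \<notin> B" "int p *s g \<in> B"
  shows "lattice_index B (span (insert g B)) = p"
proof -
  have p0: "p > 0" using prime_p prime_gt_0_nat by blast
  have eq: "residue_class B (i *s g) = residue_class B (j *s g) \<longleftrightarrow> int p dvd i - j" for i j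
    using scale_mem_iff[OF B g, of "i - j"] by (simp add: residue_class_eq_iff[OF B] algebra_simps)
  have "residue_class B ` span (insert g B) = (\<lambda>k. residue_class B (k *s g)) ` {0..<int p}"
  proof (intro equalityI subsetI)
    fix X assume "X \<in> residue_class B ` span (insert g B)"
    then obtain x k where x: "X = residue_class B x" "x - k *s g \<in> B"
      using mem_span_insert_subspace[OF B] by auto
    then have "X = residue_class B (k *s g)"
      by (simp add: residue_class_eq_iff[OF B])
    also have "\<dots> = residue_class B ((k mod int p) *s g)"
      by (simp add: eq)
    finally show "X \<in> (\<lambda>k. residue_class B (k *s g)) ` {0..<int p}"
      using p0 by auto
  next
    fix X assume "X \<in> (\<lambda>k. residue_class B (k *s g)) ` {0..<int p}"
    moreover have "k *s g \<in> span (insert g B)" for k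
      by (intro span_scale span_base) auto
    ultimately show "X \<in> residue_class B ` span (insert g B)"
      by auto
  qed
  moreover have "inj_on (\<lambda>k. residue_class B (k *s g)) {0..<int p}"
  proof (rule inj_onI)
    fix i j assume "i \<in> {0..<int p}" "j \<in> {0..<int p}" "residue_class B (i *s g) = residue_class B (j *s g)"
    then have "i mod int p = j mod int p" "i mod int p = i" "j mod int p = j"
      by (simp_all only: eq mod_eq_dvd_iff) simp_all
    then show "i = j" by simp
  qed
  ultimately show ?thesis
    by (simp add: lattice_index_def card_image)
qed

text \<open>Multiply an element of Q outside B by the largest power of p that keeps it outside
  B.\<close>

lemma exists_prime_step:
  assumes B: "subspace B" and Q: "subspace Q" "B \<subset> Q" and exp: "\<And>x. \<exists>n. int p ^ n *s x \<in> B"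
  obtains g where "g \<in> Q" "g \<notin> B" "int p *s g \<in> B"
proof -
  obtain x where x: "x \<in> Q" "x \<notin> B" using Q by auto
  define n where "n = (LEAST n. int p ^ n *s x \<in> B)"
  have n: "int p ^ n *s x \<in> B"
    unfolding n_def by (rule LeastI_ex) (rule exp)
  have "n \<noteq> 0" using n x by (intro notI) simp
  then obtain m where m: "n = Suc m" by (cases n) auto
  have "int p ^ m *s x \<notin> B"
    using not_less_Least[of m "\<lambda>n. int p ^ n *s x \<in> B"] m n_def by auto
  moreover have "int p ^ m *s x \<in> Q"
    using x Q by (auto intro: subspace_scale)
  moreover have "int p *s (int p ^ m *s x) \<in> B"
    using n m by simp
  ultimately show ?thesis using that by blast
qed

text \<open>Q is reached from A by adjoining elements of order p one at a time. Formally, a maximal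
  lattice inside Q satisfying P must be Q, since otherwise a prime step inside Q would enlarge
  it.\<close>

lemma overlattice_induct:
  assumes A: "subspace A" and fin: "finite (range (residue_class A))"
    and exp: "\<And>x. \<exists>n. int p ^ n *s x \<in> A"
    and Q: "Q \<in> overlattices A"
    and base: "P A"
    and step: "\<And>B g. B \<in> overlattices A \<Longrightarrow> P B \<Longrightarrow> g \<notin> B \<Longrightarrow> int p *s g \<in> B \<Longrightarrow> P (span (insert g B))"
  shows "P Q"
proof -
  let ?S = "{B \<in> overlattices A. B \<subseteq> Q \<and> P B}"
  have "finite ?S" using finite_overlattices[OF A fin] by simp
  moreover have "A \<in> ?S" using A Q base by (simp add: overlattices_def)
  ultimately have "\<exists>m\<in>?S. \<forall>b\<in>?S. m \<le> b \<longrightarrow> m = b"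
    by (intro finite_has_maximal) auto
  then obtain B where B: "B \<in> ?S" and max: "\<And>B'. B' \<in> ?S \<Longrightarrow> B \<subseteq> B' \<Longrightarrow> B = B'"
    by meson
  show ?thesis
  proof (cases "B = Q")
    case True
    with B show ?thesis by simp
  next
    case False
    then have "B \<subset> Q" "subspace B" "subspace Q" "A \<subseteq> B"
      using B Q by (auto simp: overlattices_def)
    moreover from this have "\<exists>n. int p ^ n *s x \<in> B" for x
      using exp by (meson subsetD)
    ultimately obtain g where g: "g \<in> Q" "g \<notin> B" "int p *s g \<in> B"
      using exists_prime_step[of B Q] by metis
    have sup: "B \<subseteq> span (insert g B)" "g \<in> span (insert g B)"
      using span_superset[of "insert g B"] by auto
    have "span (insert g B) \<subseteq> Q"
      using \<open>B \<subset> Q\<close> \<open>subspace Q\<close> g by (intro span_minimal) auto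
    moreover have "P (span (insert g B))"
      using B g by (intro step) auto
    ultimately have "span (insert g B) \<in> ?S"
      using sup \<open>A \<subseteq> B\<close> by (simp add: overlattices_def)
    then have "B = span (insert g B)"
      using sup by (intro max)
    with sup g show ?thesis by simp
  qed
qed

text \<open>Take M maximal among the proper lattices containing J: any prime step from M then
  generates everything. The pair (M, g) later becomes a linear form modulo p with kernel M.\<close>

lemma exists_maximal_overlattice:
  assumes A: "subspace A" and fin: "finite (range (residue_class A))"
    and exp: "\<And>x. \<exists>n. int p ^ n *s x \<in> A"
    and J: "J \<in> overlattices A" "J \<noteq> UNIV"
  obtains M g where "M \<in> overlattices J" "g \<notin> M" "int p *s g \<in> M" "span (insert g M) = UNIV"
proof -
  let ?S = "{M \<in> overlattices A. J \<subseteq> M \<and> M \<noteq> UNIV}"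
  have "finite ?S" using finite_overlattices[OF A fin] by simp
  moreover have "J \<in> ?S" using J by simp
  ultimately have "\<exists>m\<in>?S. \<forall>b\<in>?S. m \<le> b \<longrightarrow> m = b"
    by (intro finite_has_maximal) auto
  then obtain M where M: "M \<in> ?S" and max: "\<And>B'. B' \<in> ?S \<Longrightarrow> M \<subseteq> B' \<Longrightarrow> M = B'"
    by meson
  then have "M \<subset> UNIV" "subspace M" "A \<subseteq> M"
    by (auto simp: overlattices_def)
  moreover from this have "\<exists>n. int p ^ n *s x \<in> M" for x
    using exp by (meson subsetD)
  ultimately obtain g where g: "g \<notin> M" "int p *s g \<in> M"
    using exists_prime_step[of M UNIV] subspace_UNIV by metis
  have sup: "M \<subseteq> span (insert g M)" "g \<in> span (insert g M)"
    using span_superset[of "insert g M"] by auto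
  have "span (insert g M) = UNIV"
  proof (rule ccontr)
    assume "span (insert g M) \<noteq> UNIV"
    then have "span (insert g M) \<in> ?S"
      using M sup by (simp add: overlattices_def) blast
    then have "M = span (insert g M)"
      using sup by (intro max)
    with sup g show False by simp
  qed
  with g M show ?thesis
    by (intro that[of M g]) (auto simp: overlattices_def)
qed

end

section \<open>Lattices that split off a cyclic factor of maximal order\<close>

text \<open>The element \<open>e\<close> generates a cyclic subgroup of the quotient by \<open>A\<close> whose order
  \<open>p\<^bsup>n+1\<^esup>\<close> is an exponent of that quotient.\<close>

locale maximal_cyclic = prime_int_module scale p
  for scale :: "int \<Rightarrow> 'b::ab_group_add \<Rightarrow> 'b" (infixr "*s" 75) and p :: nat +
  fixes A :: "'b set" and e :: 'b and n :: nat
  assumes subspace_A: "subspace A"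
    and finite_quotient: "finite (range (residue_class A))"
    and exponent: "\<And>x. int p ^ Suc n *s x \<in> A"
    and scale_e_mem_iff: "\<And>k. k *s e \<in> A \<longleftrightarrow> int p ^ Suc n dvd k"
begin

abbreviation Ae :: "'b set" where "Ae \<equiv> span (insert e A)"

text \<open>Modulo A this generates the unique subgroup of order p of the cyclic group <e>, so a
  lattice avoiding it meets <e> only inside A.\<close>

definition socle :: 'b where "socle = int p ^ n *s e"

text \<open>For Q containing \<open>Ae\<close> these L correspond to the complements of
  \<open>Ae\<close> / A in Q / A; see \<open>Int_Ae\<close>.\<close>

definition fibre :: "'b set \<Rightarrow> 'b set set" where
  "fibre Q = {L \<in> overlattices A. socle \<notin> L \<and> span (insert e L) = Q}"

text \<open>A nontrivial subgroup of a cyclic p-group contains its socle, so avoiding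
  \<open>socle\<close> excludes every nonzero multiple of e modulo A.\<close>

lemma scale_e_mem_lattice_iff:
  assumes L: "L \<in> overlattices A" "socle \<notin> L"
  shows "k *s e \<in> L \<longleftrightarrow> int p ^ Suc n dvd k"
proof
  have sL: "subspace L" and AL: "A \<subseteq> L"
    using L by (auto simp: overlattices_def)
  show "k *s e \<in> L" if "int p ^ Suc n dvd k"
    using that scale_e_mem_iff AL by blast
  assume k: "k *s e \<in> L"
  have p_socle: "int p *s socle \<in> L"
    using exponent AL by (auto simp: socle_def)
  \<comment> \<open>One factor p is gained at a time: if k = p^j m, multiplying k e by p^(n-j) gives
    m times \<open>socle\<close>, which forces p to divide m.\<close>
  have "int p ^ j dvd k" if "j \<le> Suc n" for j
    using that
  proof (induction j)
    case (Suc j)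
    then obtain m where m: "k = int p ^ j * m" by auto
    have "int p ^ (n - j) *s (k *s e) \<in> L"
      using k by (rule subspace_scale[OF sL])
    moreover have "int p ^ (n - j) * k = m * int p ^ n"
      using Suc.prems by (simp add: m mult_ac flip: power_add)
    ultimately have "m *s socle \<in> L"
      by (simp add: socle_def)
    then have "int p dvd m"
      using scale_mem_iff[OF sL L(2) p_socle] by simp
    then show ?case
      by (simp add: m mult_ac mult_dvd_mono)
  qed auto
  then show "int p ^ Suc n dvd k" by blast
qed

lemma Int_Ae:
  assumes L: "L \<in> overlattices A" "socle \<notin> L"
  shows "L \<inter> Ae = A"
proof
  have sL: "subspace L" and AL: "A \<subseteq> L"
    using L by (auto simp: overlattices_def)
  show "A \<subseteq> L \<inter> Ae"
    using AL span_superset[of "insert e A"] by auto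
  show "L \<inter> Ae \<subseteq> A"
  proof
    fix x assume x: "x \<in> L \<inter> Ae"
    then obtain k where k: "x - k *s e \<in> A"
      using mem_span_insert_subspace[OF subspace_A] by auto
    have "x \<in> L" "x - k *s e \<in> L"
      using x k AL by auto
    then have "x - (x - k *s e) \<in> L"
      by (rule subspace_diff[OF sL])
    then have "k *s e \<in> A"
      using scale_e_mem_lattice_iff[OF L] scale_e_mem_iff by simp
    then show "x \<in> A"
      using subspace_add[OF subspace_A k, of "k *s e"] by simp
  qed
qed

text \<open>L / A is isomorphic to (L + Ae) / Ae = Q / Ae, because L and \<open>Ae\<close> intersect
  in A.\<close>

lemma lattice_index_fibre:
  assumes "L \<in> fibre Q"
  shows "lattice_index A L = lattice_index Ae Q"
proof -
  have L: "L \<in> overlattices A" "socle \<notin> L" "Q = span (insert e L)" "subspace L" "A \<subseteq> L"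
    using assms by (auto simp: fibre_def overlattices_def)
  have "lattice_index (L \<inter> Ae) L = lattice_index Ae Q"
    using L span_insert_conv_sum[OF _ subspace_A] by (intro lattice_index_Int) auto
  then show ?thesis
    using Int_Ae L by simp
qed

text \<open>Base case of the count of fibres: a member lies inside \<open>Ae\<close>, so it equals
  its intersection with \<open>Ae\<close>, which is A.\<close>

lemma fibre_Ae: "fibre Ae = {A}"
proof -
  have "socle \<notin> A"
    using prime_int_p by (simp add: socle_def scale_e_mem_iff prime_elem_not_unit dvd_times_left_cancel_iff
        del: dvd_mult_cancel_right) (use prime_p prime_gt_1_nat[OF prime_p] in \<open>auto dest!: zdvd_imp_le simp: not_le\<close>)
  then have "A \<in> fibre Ae"
    by (simp add: fibre_def overlattices_def subspace_A)
  moreover have "L = A" if "L \<in> fibre Ae" for L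
    using that Int_Ae[of L] span_superset[of "insert e L"] by (auto simp: fibre_def)
  ultimately show ?thesis by blast
qed

lemma socle_notin_A: "socle \<notin> A" and p_socle_in_A: "int p *s socle \<in> A"
  using fibre_Ae exponent[of e] by (auto simp: fibre_def socle_def)

text \<open>Intersecting with \<open>B\<close> maps \<open>fibre (span (insert g B))\<close> onto \<open>fibre B\<close>, and the members
  over \<open>L'\<close> are generated by \<open>L'\<close> together with \<open>g\<close> translated by one of \<open>p\<close> multiples of \<open>e\<close>.\<close>

lemma card_fibre_step:
  assumes B: "B \<in> overlattices Ae" and g: "g \<notin> B" "int p *s g \<in> B" and L': "L' \<in> fibre B"
  shows "card {L \<in> fibre (span (insert g B)). L \<inter> B = L'} = p"
proof -
  let ?Q = "span (insert g B)"
  have sB: "subspace B" and AeB: "Ae \<subseteq> B"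
    using B by (auto simp: overlattices_def)
  then have eB: "e \<in> B" and AB: "A \<subseteq> B"
    using span_superset[of "insert e A"] by auto
  have sL': "subspace L'" and AL': "A \<subseteq> L'" and L'o: "L' \<in> overlattices A" "socle \<notin> L'"
    and spanL': "span (insert e L') = B"
    using L' by (auto simp: fibre_def overlattices_def)
  have L'B: "L' \<subseteq> B"
    using spanL' span_superset[of "insert e L'"] by auto
  have e_iff: "k *s e \<in> L' \<longleftrightarrow> int p ^ Suc n dvd k" for k
    by (rule scale_e_mem_lattice_iff[OF L'o])
  have socle_B: "socle \<in> B"
    using eB sB by (simp add: socle_def subspace_scale)
  \<comment> \<open>Write p g as an element of L' plus t e. As p^(n+1) g lies in A, p^n t e lies in
    L', so p divides t, and y = -t / p works. Maximality of the order of e enters here.\<close>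
  obtain y where y: "int p *s (g + y *s e) \<in> L'"
  proof -
    obtain t where t: "int p *s g - t *s e \<in> L'"
      using g spanL' mem_span_insert_subspace[OF sL'] by blast
    have "int p ^ n *s (int p *s g - t *s e) \<in> L'"
      using t by (rule subspace_scale[OF sL'])
    moreover have "int p ^ n *s (int p *s g) \<in> L'"
      using exponent[of g] AL' by (auto simp: mult.commute)
    ultimately have "int p ^ n *s (int p *s g) - int p ^ n *s (int p *s g - t *s e) \<in> L'"
      by (intro subspace_diff[OF sL'])
    then have "(int p ^ n * t) *s e \<in> L'"
      by (simp add: algebra_simps)
    then have "int p dvd t"
      using prime_p prime_gt_0_nat[OF prime_p] by (simp add: e_iff mult.commute[of "int p ^ n"])
    then obtain m where "t = int p * m" by auto
    then have "int p *s (g + (- m) *s e) \<in> L'"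
      using t by (simp add: algebra_simps)
    then show ?thesis by (rule that)
  qed
  \<comment> \<open>Translating by multiples of \<open>socle\<close> keeps p times the element in
    L', since p times \<open>socle\<close> lies in A. Only j modulo p matters for the lattice, which
    gives p candidates.\<close>
  define h where "h j = g + y *s e + j *s socle" for j
  define N where "N j = span (insert (h j) L')" for j
  have ph: "int p *s h j \<in> L'" for j
  proof -
    have "j *s (int p *s socle) \<in> L'"
      using p_socle_in_A AL' subspace_scale[OF sL', of "int p *s socle" j] by auto
    then have "int p *s (g + y *s e) + j *s (int p *s socle) \<in> L'"
      using y by (intro subspace_add[OF sL'])
    then show ?thesis
      by (simp add: h_def scale_right_distrib mult.commute)
  qed
  have hg: "h j - g \<in> B" for j
    unfolding h_def using eB socle_B by (auto simp: algebra_simps intro!: subspace_add[OF sB] subspace_scale[OF sB])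
  have hB: "h j \<notin> B" for j
    using hg[of j] g subspace_diff[OF sB, of "h j" "h j - g"] by auto
  have h_mem: "k *s h j \<in> L' \<longleftrightarrow> int p dvd k" and h_memB: "k *s h j \<in> B \<longleftrightarrow> int p dvd k" for k j
    using ph[of j] hB[of j] L'B scale_mem_iff[OF sL', of "h j" k] scale_mem_iff[OF sB, of "h j" k] by auto
  have N_Int: "N j \<inter> B = L'" for j
  proof
    show "L' \<subseteq> N j \<inter> B"
      using L'B span_superset[of "insert (h j) L'"] by (auto simp: N_def)
    show "N j \<inter> B \<subseteq> L'"
    proof
      fix x assume x: "x \<in> N j \<inter> B"
      then obtain k where k: "x - k *s h j \<in> L'"
        using mem_span_insert_subspace[OF sL'] by (auto simp: N_def)
      have "x \<in> B" "x - k *s h j \<in> B"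
        using x k L'B by auto
      then have "x - (x - k *s h j) \<in> B"
        by (rule subspace_diff[OF sB])
      then have "k *s h j \<in> L'"
        by (simp add: h_mem h_memB)
      then show "x \<in> L'"
        using subspace_add[OF sL' k, of "k *s h j"] by simp
    qed
  qed
  have hQ: "h j \<in> ?Q" for j
    using hg[of j] span_add[of "h j - g" "insert g B" g] by (simp add: span_base)
  have "N j \<in> fibre ?Q" for j
  proof -
    have sub: "insert (h j) L' \<subseteq> N j"
      unfolding N_def by (rule span_superset)
    have sub': "insert e (N j) \<subseteq> span (insert e (N j))"
      by (rule span_superset)
    have "socle \<notin> N j"
      using N_Int[of j] socle_B L'o by auto
    moreover have "A \<subseteq> N j" using AL' sub by auto
    moreover have "span (insert e (N j)) = ?Q"
    proof
      have "N j \<subseteq> ?Q"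
        unfolding N_def using hQ L'B span_superset[of "insert g B"] by (intro span_minimal) auto
      moreover have "e \<in> ?Q" using eB by (simp add: span_base)
      ultimately show "span (insert e (N j)) \<subseteq> ?Q"
        by (intro span_minimal) auto
      have BN: "B \<subseteq> span (insert e (N j))"
        unfolding spanL'[symmetric] using sub by (intro span_mono) auto
      have "h j \<in> span (insert e (N j))"
        using sub sub' by auto
      moreover have "h j - g \<in> span (insert e (N j))"
        using BN hg by (rule subsetD)
      ultimately have "h j - (h j - g) \<in> span (insert e (N j))"
        by (rule span_diff)
      then show "?Q \<subseteq> span (insert e (N j))"
        using BN by (intro span_minimal) auto
    qed
    ultimately show ?thesis
      by (simp add: fibre_def overlattices_def N_def)
  qed
  with N_Int have N_mem: "N j \<in> {L \<in> fibre ?Q. L \<inter> B = L'}" for j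
    by simp
  \<comment> \<open>A member L contains some g - k e. Comparison with g + y e shows that p^n divides
    y + k, so the two elements differ by a multiple t of \<open>socle\<close>.\<close>
  have "\<exists>j\<in>{0..<int p}. L = N j" if L: "L \<in> fibre ?Q" and LB: "L \<inter> B = L'" for L
  proof -
    have sL: "subspace L" and L'L: "L' \<subseteq> L" and spanL: "span (insert e L) = ?Q"
      and Lo: "L \<in> overlattices A" "socle \<notin> L"
      using L LB by (auto simp: fibre_def overlattices_def)
    have "g \<in> span (insert e L)"
      unfolding spanL by (simp add: span_base)
    then obtain k where k: "g - k *s e \<in> L"
      using mem_span_insert_subspace[OF sL] by blast
    have "int p *s (g + y *s e) - int p *s (g - k *s e) \<in> L"
      using y k L'L by (intro subspace_diff[OF sL] subspace_scale[OF sL k]) auto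
    then have "(int p * (y + k)) *s e \<in> L"
      by (simp add: algebra_simps)
    then have "int p ^ n dvd y + k"
      using prime_gt_0_nat[OF prime_p] by (simp add: scale_e_mem_lattice_iff[OF Lo])
    then obtain t where t: "y + k = int p ^ n * t" by auto
    \<comment> \<open>This residue makes h j differ from g - k e by a multiple of p^(n+1) e, hence
      by an element of L.\<close>
    define j where "j = (- t) mod int p"
    have j: "j \<in> {0..<int p}"
      using prime_gt_0_nat[OF prime_p] by (simp add: j_def)
    have "int p dvd j + t"
      unfolding j_def by (metis add.commute add.right_inverse mod_0_imp_dvd mod_add_right_eq mod_0)
    then have "int p ^ Suc n dvd y + k + j * int p ^ n"
      by (simp add: t mult.commute flip: distrib_left) (metis add.commute distrib_left mult_dvd_mono dvd_refl mult.commute)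
    then have "(y + k + j * int p ^ n) *s e \<in> L"
      by (simp add: scale_e_mem_lattice_iff[OF Lo])
    then have "(g - k *s e) + (y + k + j * int p ^ n) *s e \<in> L"
      using k by (intro subspace_add[OF sL])
    then have hL: "h j \<in> L"
      by (simp add: h_def socle_def algebra_simps)
    have NL: "N j \<subseteq> L"
      unfolding N_def using hL L'L sL by (intro span_minimal) auto
    have "L \<subseteq> N j"
    proof
      fix x assume x: "x \<in> L"
      then have "x \<in> ?Q"
        using spanL span_superset[of "insert e L"] by auto
      then obtain m where m: "x - m *s g \<in> B"
        using mem_span_insert_subspace[OF sB] by auto
      have "x - m *s h j \<in> L"
        using x hL by (intro subspace_diff[OF sL] subspace_scale[OF sL])
      moreover have "(x - m *s g) - m *s (h j - g) \<in> B"
        by (rule subspace_diff[OF sB m subspace_scale[OF sB hg]])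
      then have "x - m *s h j \<in> B"
        by (simp add: algebra_simps)
      ultimately have "x - m *s h j \<in> L'"
        using LB by auto
      then show "x \<in> N j"
        unfolding N_def mem_span_insert_subspace[OF sL'] by blast
    qed
    with NL j show ?thesis by blast
  qed
  with N_mem have "{L \<in> fibre ?Q. L \<inter> B = L'} = N ` {0..<int p}"
    by blast
  moreover have "inj_on N {0..<int p}"
  proof (rule inj_onI)
    fix i j assume ij: "i \<in> {0..<int p}" "j \<in> {0..<int p}" "N i = N j"
    have "h i \<in> N j" "h j \<in> N j"
      using ij(3) by (auto simp: N_def intro: span_base)
    then have "h i - h j \<in> N j"
      unfolding N_def by (rule span_diff)
    then have d: "(i - j) *s socle \<in> N j"
      by (simp add: h_def algebra_simps)
    moreover have "(i - j) *s socle \<in> B"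
      using socle_B by (rule subspace_scale[OF sB])
    ultimately have "(i - j) *s socle \<in> L'"
      using N_Int[of j] by blast
    then have "int p dvd i - j"
      using scale_mem_iff[OF sL' L'o(2)] p_socle_in_A AL' by blast
    then have "i mod int p = j mod int p" "i mod int p = i" "j mod int p = j"
      using ij by (simp_all only: mod_eq_dvd_iff) simp_all
    then show "i = j" by simp
  qed
  ultimately show ?thesis
    by (simp add: card_image)
qed

lemma subspace_Ae: "subspace Ae" and A_subset_Ae: "A \<subseteq> Ae"
  using span_superset[of "insert e A"] by auto

lemma finite_overlattices_A: "finite (overlattices A)"
  by (rule finite_overlattices[OF subspace_A finite_quotient])

lemma finite_fibre: "finite (fibre Q)"
  using finite_overlattices_A by (simp add: fibre_def)

text \<open>Both sides are multiplied by p at each prime step, by \<open>card_fibre_step\<close> on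
  the left and by multiplicativity of the index on the right. This is the count of homomorphisms
  from Q / Ae to the cyclic group generated by e.\<close>

lemma card_fibre:
  assumes "Q \<in> overlattices Ae"
  shows "card (fibre Q) = lattice_index Ae Q"
  using subspace_Ae _ _ assms
proof (rule overlattice_induct)
  show "finite (range (residue_class Ae))"
    by (rule finite_range_residue_class_mono[OF subspace_A subspace_Ae A_subset_Ae finite_quotient])
  show "\<exists>m. int p ^ m *s x \<in> Ae" for x
    using exponent A_subset_Ae by blast
  show "card (fibre Ae) = lattice_index Ae Ae"
    by (simp add: fibre_Ae lattice_index_self)
  fix B g
  assume B: "B \<in> overlattices Ae" and IH: "card (fibre B) = lattice_index Ae B"
    and g: "g \<notin> B" "int p *s g \<in> B"
  let ?Q = "span (insert g B)"
  have sB: "subspace B" and AeB: "Ae \<subseteq> B"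
    using B by (auto simp: overlattices_def)
  have eB: "e \<in> B" using AeB span_superset[of "insert e A"] by auto
  have BQ: "B \<subseteq> ?Q" using span_superset[of "insert g B"] by auto
  have "L \<inter> B \<in> fibre B" if L: "L \<in> fibre ?Q" for L
  proof -
    have sL: "subspace L" and AL: "A \<subseteq> L" and so: "socle \<notin> L" and spanL: "span (insert e L) = ?Q"
      using L by (auto simp: fibre_def overlattices_def)
    have sI: "subspace (L \<inter> B)" by (rule subspace_inter[OF sL sB])
    have "x \<in> span (insert e (L \<inter> B))" if x: "x \<in> B" for x
    proof -
      have "x \<in> span (insert e L)" using x BQ spanL by auto
      then obtain k where k: "x - k *s e \<in> L"
        using mem_span_insert_subspace[OF sL] by auto
      moreover have "x - k *s e \<in> B"
        using x eB by (intro subspace_diff[OF sB] subspace_scale[OF sB])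
      ultimately show ?thesis
        unfolding mem_span_insert_subspace[OF sI] by blast
    qed
    moreover have "span (insert e (L \<inter> B)) \<subseteq> B"
      using eB sB by (intro span_minimal) auto
    ultimately show ?thesis
      using sI so AL AeB A_subset_Ae by (auto simp: fibre_def overlattices_def)
  qed
  then have "fibre ?Q = (\<Union>L'\<in>fibre B. {L \<in> fibre ?Q. L \<inter> B = L'})"
    by auto
  also have "card \<dots> = (\<Sum>L'\<in>fibre B. card {L \<in> fibre ?Q. L \<inter> B = L'})"
    using finite_fibre by (intro card_UN_disjoint) auto
  also have "\<dots> = (\<Sum>L'\<in>fibre B. p)"
    using card_fibre_step[OF B g] by (intro sum.cong) auto
  also have "\<dots> = lattice_index Ae B * p"
    by (simp add: IH)
  also have "\<dots> = lattice_index Ae ?Q"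
    using lattice_index_mult[OF subspace_Ae sB subspace_span AeB BQ] lattice_index_span_insert[OF sB g] by simp
  finally show "card (fibre ?Q) = lattice_index Ae ?Q" .
qed

text \<open>Split by whether L contains \<open>socle\<close>. If so, L lies over the larger lattice,
  and each index gains a factor p. The others are grouped by Q = L + <e>: a group has [Q : Ae]
  members, each of index [Q : Ae], which raises the exponent from k to k + 1.\<close>

theorem sum_lattice_index_power:
  "(\<Sum>L\<in>overlattices A. lattice_index A L ^ k) =
     p ^ k * (\<Sum>L\<in>overlattices (span (insert socle A)). lattice_index (span (insert socle A)) L ^ k)
     + (\<Sum>Q\<in>overlattices Ae. lattice_index Ae Q ^ Suc k)"
proof -
  let ?A' = "span (insert socle A)"
  have A': "subspace ?A'" "A \<subseteq> ?A'" "socle \<in> ?A'"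
    using span_superset[of "insert socle A"] by auto
  let ?S = "{L \<in> overlattices A. socle \<notin> L}"
  have split: "overlattices A = overlattices ?A' \<union> ?S"
  proof (intro equalityI subsetI)
    fix L assume L: "L \<in> overlattices A"
    have "?A' \<subseteq> L" if "socle \<in> L"
      using L that by (intro span_minimal) (auto simp: overlattices_def)
    then show "L \<in> overlattices ?A' \<union> ?S"
      using L by (auto simp: overlattices_def)
  qed (use A' in \<open>auto simp: overlattices_def\<close>)
  have disj: "overlattices ?A' \<inter> ?S = {}"
    using A' by (auto simp: overlattices_def)
  have fin: "finite (overlattices ?A')" "finite ?S"
    using finite_overlattices_A split by (metis finite_Un)+
  have "(\<Sum>L\<in>overlattices A. lattice_index A L ^ k) = (\<Sum>L\<in>overlattices ?A' \<union> ?S. lattice_index A L ^ k)"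
    by (rule sum.cong[OF split refl])
  also have "\<dots> = (\<Sum>L\<in>overlattices ?A'. lattice_index A L ^ k) + (\<Sum>L\<in>?S. lattice_index A L ^ k)"
    by (rule sum.union_disjoint[OF fin disj])
  also have "(\<Sum>L\<in>overlattices ?A'. lattice_index A L ^ k) = (\<Sum>L\<in>overlattices ?A'. p ^ k * lattice_index ?A' L ^ k)"
  proof (intro sum.cong refl)
    fix L assume L: "L \<in> overlattices ?A'"
    then have "lattice_index A L = p * lattice_index ?A' L"
      using lattice_index_mult[OF subspace_A A'(1) _ A'(2)] lattice_index_span_insert[OF subspace_A socle_notin_A p_socle_in_A]
      by (simp add: overlattices_def)
    then show "lattice_index A L ^ k = p ^ k * lattice_index ?A' L ^ k"
      by (simp add: power_mult_distrib)
  qed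
  also have "\<dots> = p ^ k * (\<Sum>L\<in>overlattices ?A'. lattice_index ?A' L ^ k)"
    by (simp add: sum_distrib_left)
  also have "?S = (\<Union>Q\<in>overlattices Ae. fibre Q)"
  proof (intro equalityI subsetI)
    fix L assume "L \<in> ?S"
    then have L: "L \<in> fibre (span (insert e L))" "A \<subseteq> L"
      by (auto simp: fibre_def overlattices_def)
    have "Ae \<subseteq> span (insert e L)"
      using L(2) by (intro span_mono) auto
    then have "span (insert e L) \<in> overlattices Ae"
      by (simp add: overlattices_def)
    then show "L \<in> (\<Union>Q\<in>overlattices Ae. fibre Q)"
      using L(1) by (rule UN_I)
  qed (auto simp: fibre_def)
  also have "(\<Sum>L\<in>\<dots>. lattice_index A L ^ k) = (\<Sum>Q\<in>overlattices Ae. \<Sum>L\<in>fibre Q. lattice_index A L ^ k)"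
  proof (intro sum.UNION_disjoint ballI)
    show "finite (overlattices Ae)"
      by (rule finite_overlattices[OF subspace_Ae
            finite_range_residue_class_mono[OF subspace_A subspace_Ae A_subset_Ae finite_quotient]])
  qed (auto simp: finite_fibre, auto simp: fibre_def)
  also have "\<dots> = (\<Sum>Q\<in>overlattices Ae. lattice_index Ae Q ^ Suc k)"
    by (intro sum.cong refl) (simp add: lattice_index_fibre card_fibre)
  finally show ?thesis .
qed

end

section \<open>Counting overlattices in \<open>\<int>\<^sup>3\<close>\<close>

definition scale3 :: "int \<Rightarrow> int \<times> int \<times> int \<Rightarrow> int \<times> int \<times> int" where
  "scale3 k = (\<lambda>(x, y, z). (k * x, k * y, k * z))"

lemma scale3_Pair [simp]: "scale3 k (x, y, z) = (k * x, k * y, k * z)"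
  by (simp add: scale3_def)

interpretation Z3: int_module scale3
  by unfold_locales (auto simp: scale3_def algebra_simps)

text \<open>The kernel of reduction onto the product of the three cyclic groups. An exponent 0 makes
  a factor trivial, and the exponents 1, 1, 1 give p Z^3.\<close>

definition diag_lattice :: "nat \<Rightarrow> nat \<Rightarrow> nat \<Rightarrow> nat \<Rightarrow> (int \<times> int \<times> int) set" where
  "diag_lattice p a b c = {(x, y, z). int p ^ a dvd x \<and> int p ^ b dvd y \<and> int p ^ c dvd z}"

lemma mem_diag_lattice [simp]:
  "(x, y, z) \<in> diag_lattice p a b c \<longleftrightarrow> int p ^ a dvd x \<and> int p ^ b dvd y \<and> int p ^ c dvd z"
  by (simp add: diag_lattice_def)

text \<open>The sum \<open>S\<^sub>k(a, b, c)\<close>; for k = 0 it counts the overlattices.\<close>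

definition weighted_count :: "nat \<Rightarrow> nat \<Rightarrow> nat \<Rightarrow> nat \<Rightarrow> nat \<Rightarrow> nat" where
  "weighted_count p k a b c = (\<Sum>L\<in>Z3.overlattices (diag_lattice p a b c). lattice_index (diag_lattice p a b c) L ^ k)"

lemma subspace_diag_lattice: "Z3.subspace (diag_lattice p a b c)"
  by (auto simp: Z3.subspace_def zero_prod_def)

lemma finite_quotient_diag_lattice:
  assumes "p > 0"
  shows "finite (range (residue_class (diag_lattice p a b c)))"
proof (rule finite_subset)
  let ?B = "{0..<int p ^ a} \<times> {0..<int p ^ b} \<times> {0..<int p ^ c}"
  show "range (residue_class (diag_lattice p a b c)) \<subseteq> residue_class (diag_lattice p a b c) ` ?B"
  proof clarify
    fix x y z :: int
    have "residue_class (diag_lattice p a b c) (x, y, z) = residue_class (diag_lattice p a b c) (x mod int p ^ a, y mod int p ^ b, z mod int p ^ c)"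
      by (simp add: Z3.residue_class_eq_iff[OF subspace_diag_lattice])
    then show "residue_class (diag_lattice p a b c) (x, y, z) \<in> residue_class (diag_lattice p a b c) ` ?B"
      using assms by auto
  qed
qed simp

lemma finite_overlattices_diag_lattice:
  assumes "p > 0"
  shows "finite (Z3.overlattices (diag_lattice p a b c))"
  by (rule Z3.finite_overlattices[OF subspace_diag_lattice finite_quotient_diag_lattice[OF assms]])

lemma module_homI3:
  assumes "\<And>u v. T (u + v) = T u + T v" "\<And>k v. T (scale3 k v) = scale3 k (T v)"
  shows "module_hom scale3 scale3 T"
  using assms by unfold_locales auto

lemma weighted_count_image:
  assumes T: "module_hom scale3 scale3 T" and inj: "inj T" and surj: "surj T"
    and diag_lattice: "T ` diag_lattice p a b c = diag_lattice p a' b' c'"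
  shows "weighted_count p k a b c = weighted_count p k a' b' c'"
proof -
  have bij: "bij_betw ((`) T) (Z3.overlattices (diag_lattice p a b c)) (Z3.overlattices (diag_lattice p a' b' c'))"
    using Z3.bij_betw_image_overlattices[OF T inj, of "diag_lattice p a b c" UNIV] surj by (simp add: diag_lattice)
  have "weighted_count p k a' b' c' = (\<Sum>L\<in>Z3.overlattices (diag_lattice p a b c). lattice_index (T ` diag_lattice p a b c) (T ` L) ^ k)"
    unfolding weighted_count_def diag_lattice by (rule sum.reindex_bij_betw[OF bij, symmetric])
  then show ?thesis
    by (simp add: weighted_count_def Z3.lattice_index_image[OF T inj])
qed

lemma weighted_count_swap12: "weighted_count p k a b c = weighted_count p k b a c"
proof (rule weighted_count_image)
  let ?T = "\<lambda>(x, y, z). (y, x, z) :: int \<times> int \<times> int"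
  show "module_hom scale3 scale3 ?T" by (rule module_homI3) auto
  show "inj ?T" by (auto simp: inj_def)
  show "surj ?T" by (auto simp: surj_def)
  have "(y, x, z) \<in> ?T ` diag_lattice p a b c" if "(y, x, z) \<in> diag_lattice p b a c" for x y z
    using that by (intro image_eqI[where x = "(x, y, z)"]) auto
  then show "?T ` diag_lattice p a b c = diag_lattice p b a c"
    by auto
qed

lemma weighted_count_swap23: "weighted_count p k a b c = weighted_count p k a c b"
proof (rule weighted_count_image)
  let ?T = "\<lambda>(x, y, z). (x, z, y) :: int \<times> int \<times> int"
  show "module_hom scale3 scale3 ?T" by (rule module_homI3) auto
  show "inj ?T" by (auto simp: inj_def)
  show "surj ?T" by (auto simp: surj_def)
  have "(x, z, y) \<in> ?T ` diag_lattice p a b c" if "(x, z, y) \<in> diag_lattice p a c b" for x y z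
    using that by (intro image_eqI[where x = "(x, y, z)"]) auto
  then show "?T ` diag_lattice p a b c = diag_lattice p a c b"
    by auto
qed

lemma weighted_count_0: "weighted_count p k 0 0 0 = 1"
proof -
  have "diag_lattice p 0 0 0 = UNIV" by auto
  then have "Z3.overlattices (diag_lattice p 0 0 0) = {diag_lattice p 0 0 0}"
    by (auto simp: Z3.overlattices_def)
  then show ?thesis
    by (simp add: weighted_count_def Z3.lattice_index_self[OF subspace_diag_lattice])
qed

text \<open>Take e to be the first unit vector, whose order is maximal by the bounds on b and c.
  Adjoining \<open>socle\<close> lowers the first exponent by one, and adjoining e lowers it to
  0.\<close>

lemma weighted_count_Suc:
  assumes p: "Factorial_Ring.prime p" and b: "b \<le> Suc n" and c: "c \<le> Suc n"
  shows "weighted_count p k (Suc n) b c = p ^ k * weighted_count p k n b c + weighted_count p (Suc k) 0 b c"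
proof -
  have p0: "p > 0" using p by (rule prime_gt_0_nat)
  interpret mc: maximal_cyclic scale3 p "diag_lattice p (Suc n) b c" "(1, 0, 0)" n
  proof
    show "Z3.subspace (diag_lattice p (Suc n) b c)" by (rule subspace_diag_lattice)
    show "finite (range (residue_class (diag_lattice p (Suc n) b c)))" by (rule finite_quotient_diag_lattice[OF p0])
    show "scale3 (int p ^ Suc n) v \<in> diag_lattice p (Suc n) b c" for v
      by (cases v) (auto simp del: power_Suc intro!: dvd_mult2 le_imp_power_dvd b c)
  qed (use p in auto)
  have "\<exists>j. int p ^ Suc n dvd x - j" for x :: int
    by (rule exI[of _ x]) simp
  then have e: "mc.Ae = diag_lattice p 0 b c"
    by (auto simp: Z3.mem_span_insert_subspace[OF subspace_diag_lattice])
  have s: "Z3.span (insert mc.socle (diag_lattice p (Suc n) b c)) = diag_lattice p n b c"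
  proof (intro equalityI subsetI)
    fix v assume "v \<in> Z3.span (insert mc.socle (diag_lattice p (Suc n) b c))"
    then obtain j where j: "v - scale3 j mc.socle \<in> diag_lattice p (Suc n) b c"
      unfolding Z3.mem_span_insert_subspace[OF subspace_diag_lattice] by blast
    obtain x y z where v: "v = (x, y, z)" by (cases v)
    have "int p ^ n dvd x - j * int p ^ n"
      using j power_le_dvd[of "int p" "Suc n" "x - j * int p ^ n" n] by (simp add: v mc.socle_def)
    then have "int p ^ n dvd x"
      using dvd_diff_commute dvd_triv_right by (metis diff_add_cancel dvd_add)
    with j show "v \<in> diag_lattice p n b c"
      by (simp add: v mc.socle_def)
  next
    fix v assume v: "v \<in> diag_lattice p n b c"
    obtain x y z where xyz: "v = (x, y, z)" by (cases v)
    with v obtain j where "x = int p ^ n * j" by auto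
    then have "v - scale3 j mc.socle \<in> diag_lattice p (Suc n) b c"
      using v by (simp add: xyz mc.socle_def)
    then show "v \<in> Z3.span (insert mc.socle (diag_lattice p (Suc n) b c))"
      unfolding Z3.mem_span_insert_subspace[OF subspace_diag_lattice] by blast
  qed
  show ?thesis
    using mc.sum_lattice_index_power[of k] unfolding e s weighted_count_def .
qed

section \<open>Solving the recurrence in closed form\<close>

text \<open>With one cyclic factor the recurrence is a geometric sum with ratio p^2.\<close>

lemma weighted_count_2:
  assumes p: "Factorial_Ring.prime p"
  shows "(real p ^ 2 - 1) * real (weighted_count p 2 c 0 0) = real p ^ (2 * c + 2) - 1"
proof (induction c)
  case 0
  then show ?case by (simp add: weighted_count_0 power2_eq_square)
next
  case (Suc c)
  have "weighted_count p 2 (Suc c) 0 0 = p ^ 2 * weighted_count p 2 c 0 0 + 1"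
    using weighted_count_Suc[OF p, of 0 c 0 2] by (simp add: weighted_count_0)
  then have "(real p ^ 2 - 1) * real (weighted_count p 2 (Suc c) 0 0)
      = real p ^ 2 * ((real p ^ 2 - 1) * real (weighted_count p 2 c 0 0)) + (real p ^ 2 - 1)"
    by (simp add: algebra_simps)
  also have "\<dots> = real p ^ (2 * Suc c + 2) - 1"
    unfolding Suc.IH by (simp add: algebra_simps power_add power2_eq_square)
  finally show ?case .
qed

lemma weighted_count_1:
  assumes p: "Factorial_Ring.prime p" and "c \<le> b"
  shows "(real p ^ 2 - 1) * (real p - 1) * real (weighted_count p 1 b c 0)
    = (real c + 1) * real p ^ (b + c + 1) * (real p ^ 2 - 1) - real p ^ (2 * c + 2) + 1"
  using \<open>c \<le> b\<close>
proof (induction "b + c" arbitrary: b c rule: less_induct)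
  case less
  show ?case
  proof (cases b)
    case 0
    then show ?thesis using less.prems by (simp add: weighted_count_0 algebra_simps power2_eq_square)
  next
    case (Suc n)
    have w2: "(real p ^ 2 - 1) * real (weighted_count p 2 0 c 0) = real p ^ (2 * c + 2) - 1"
      using weighted_count_2[OF p, of c] by (simp add: weighted_count_swap12[of p 2 0 c])
    have IH: "(real p ^ 2 - 1) * (real p - 1) * real (weighted_count p 1 n c 0)
      = (real c + 1) * real p ^ (n + c + 1) * (real p ^ 2 - 1) - real p ^ (2 * c + 2) + 1"
    proof (cases "c \<le> n")
      case True
      then show ?thesis using less.hyps[of n c] Suc by simp
    next
      \<comment> \<open>Here b = c, so lowering b breaks the order. Symmetry of the count restores
        it, and the closed form takes equal values at (n, n + 1) and (n + 1, n).\<close>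
      case False
      then have c: "c = Suc n" using less.prems Suc by simp
      have "(real p ^ 2 - 1) * (real p - 1) * real (weighted_count p 1 c n 0)
        = (real n + 1) * real p ^ (c + n + 1) * (real p ^ 2 - 1) - real p ^ (2 * n + 2) + 1"
        using less.hyps[of c n] Suc c by simp
      moreover have "weighted_count p 1 n c 0 = weighted_count p 1 c n 0"
        by (rule weighted_count_swap12)
      ultimately show ?thesis
        by (simp add: c) (simp add: algebra_simps power_add power_mult power_mult_distrib power2_eq_square)
    qed
    have "weighted_count p 1 b c 0 = p * weighted_count p 1 n c 0 + weighted_count p 2 0 c 0"
      using weighted_count_Suc[OF p, of c n 0 1] less.prems Suc by (simp add: numeral_2_eq_2)
    then have "(real p ^ 2 - 1) * (real p - 1) * real (weighted_count p 1 b c 0)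
      = real p * ((real p ^ 2 - 1) * (real p - 1) * real (weighted_count p 1 n c 0))
       + (real p - 1) * ((real p ^ 2 - 1) * real (weighted_count p 2 0 c 0))"
      by (simp add: algebra_simps)
    also have "\<dots> = (real c + 1) * real p ^ (b + c + 1) * (real p ^ 2 - 1) - real p ^ (2 * c + 2) + 1"
      unfolding IH w2 Suc by (simp add: algebra_simps power_add power_mult power_mult_distrib power2_eq_square)
    finally show ?thesis .
  qed
qed

text \<open>Lowering the first of two equal exponents puts them out of order by one. This identity
  and the next handle exactly that case, as the numerator is not symmetric in general.\<close>

lemma f_numerator_swap12: "f_numerator p a (Suc a) c = f_numerator p (Suc a) a c"
  by (simp add: f_numerator_def algebra_simps power_add power2_eq_square eval_nat_numeral)

lemma f_numerator_swap23: "f_numerator p a b (Suc b) = f_numerator p a (Suc b) b"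
  by (simp add: f_numerator_def algebra_simps power_add power2_eq_square eval_nat_numeral)

text \<open>The increment is p^2 - 1 times the closed form in \<open>weighted_count_1\<close>, so
  the numerator obeys the recurrence for k = 0 with denominators cleared.\<close>

lemma f_numerator_Suc:
  "f_numerator p (Suc a) b c = f_numerator p a b c
    + (real p ^ 2 - 1) * ((real c + 1) * real p ^ (b + c + 1) * (real p ^ 2 - 1) - real p ^ (2 * c + 2) + 1)"
  by (simp add: f_numerator_def algebra_simps power_add power2_eq_square eval_nat_numeral)

lemma f_numerator_0: "f_numerator p 0 0 0 = (real p ^ 2 - 1) ^ 2 * (real p - 1)"
  by (simp add: f_numerator_def algebra_simps power_add power2_eq_square eval_nat_numeral)

lemma weighted_count_0_eq_numerator:
  assumes p: "Factorial_Ring.prime p" and "c \<le> b" "b \<le> a"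
  shows "(real p ^ 2 - 1) ^ 2 * (real p - 1) * real (weighted_count p 0 a b c) = f_numerator p a b c"
  using assms(2,3)
proof (induction "a + b + c" arbitrary: a b c rule: less_induct)
  case less
  show ?case
  proof (cases a)
    case 0
    then show ?thesis using less.prems by (simp add: weighted_count_0 f_numerator_0)
  next
    case (Suc n)
    have IH: "(real p ^ 2 - 1) ^ 2 * (real p - 1) * real (weighted_count p 0 n b c) = f_numerator p n b c"
    proof (cases "b \<le> n")
      case True
      then show ?thesis using less Suc by simp
    next
      case False
      then have b: "b = Suc n" using less.prems Suc by simp
      show ?thesis
      proof (cases "c \<le> n")
        case True
        then show ?thesis
          using less.hyps[of b n c] Suc b f_numerator_swap12[of p n c] weighted_count_swap12[of p 0 n b c] by simp
      next
        \<comment> \<open>All three exponents equal n + 1, so the lowered one moves to the last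
          place through two exchanges.\<close>
        case False
        then have c: "c = Suc n" using less.prems b by simp
        have "weighted_count p 0 n b c = weighted_count p 0 b c n"
          using weighted_count_swap12 weighted_count_swap23 by metis
        then show ?thesis
          using less.hyps[of b c n] Suc b c f_numerator_swap12[of p n c] f_numerator_swap23[of p c n] by simp
      qed
    qed
    have "weighted_count p 0 a b c = weighted_count p 0 n b c + weighted_count p 1 0 b c"
      using weighted_count_Suc[OF p, of b n c 0] less.prems Suc by simp
    moreover have "weighted_count p 1 0 b c = weighted_count p 1 b c 0"
      using weighted_count_swap12 weighted_count_swap23 by metis
    ultimately have "(real p ^ 2 - 1) ^ 2 * (real p - 1) * real (weighted_count p 0 a b c)
      = (real p ^ 2 - 1) ^ 2 * (real p - 1) * real (weighted_count p 0 n b c)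
        + (real p ^ 2 - 1) * ((real p ^ 2 - 1) * (real p - 1) * real (weighted_count p 1 b c 0))"
      by (simp add: algebra_simps power2_eq_square)
    also have "\<dots> = f_numerator p a b c"
      unfolding IH weighted_count_1[OF p less.prems(1)] Suc f_numerator_Suc ..
    finally show ?thesis .
  qed
qed

definition num_overlattices :: "nat \<Rightarrow> nat \<Rightarrow> nat \<Rightarrow> nat \<Rightarrow> nat" where
  "num_overlattices p a b c = card (Z3.overlattices (diag_lattice p a b c))"

lemma num_overlattices_swap12: "num_overlattices p a b c = num_overlattices p b a c"
  and num_overlattices_swap23: "num_overlattices p a b c = num_overlattices p a c b"
  using weighted_count_swap12[of p 0] weighted_count_swap23[of p 0]
  by (simp_all add: weighted_count_def num_overlattices_def)

lemma f_expr_eq_num_overlattices_sorted: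
  assumes p: "Factorial_Ring.prime p" and "c \<le> b" "b \<le> a"
  shows "f_expr p a b c = real (num_overlattices p a b c)"
proof -
  have "real p > 1" using prime_gt_1_nat[OF p] by simp
  then have "(real p ^ 2 - 1) ^ 2 * (real p - 1) \<noteq> 0"
    by (simp add: power2_eq_1_iff)
  then show ?thesis
    using weighted_count_0_eq_numerator[OF assms]
    by (simp add: f_expr_def num_overlattices_def weighted_count_def field_simps)
qed

lemma f_expr_swap12: "f_expr p a (Suc a) c = f_expr p (Suc a) a c"
  and f_expr_swap23: "f_expr p a b (Suc b) = f_expr p a (Suc b) b"
  by (simp_all add: f_expr_def f_numerator_swap12 f_numerator_swap23)

text \<open>The formula for \<open>f\<close> is not symmetric, but it does tolerate neighbouring arguments that
  are out of order by one.\<close>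

lemma f_expr_eq_num_overlattices:
  assumes p: "Factorial_Ring.prime p" and "b \<le> Suc a" "c \<le> Suc b" "c \<le> Suc a"
  shows "f_expr p a b c = real (num_overlattices p a b c)"
proof -
  have *: "f_expr p a b c = real (num_overlattices p a b c)" if "b \<le> a" "c \<le> Suc b" for a b c
  proof (cases "c \<le> b")
    case True
    then show ?thesis using that f_expr_eq_num_overlattices_sorted[OF p] by simp
  next
    case False
    then have c: "c = Suc b" using that by simp
    show ?thesis
    proof (cases "Suc b \<le> a")
      case True
      then show ?thesis
        using f_expr_eq_num_overlattices_sorted[OF p, of b "Suc b" a]
        by (simp add: c f_expr_swap23 num_overlattices_swap23[of p a b])
    next
      case False
      then have "a = b" using that by simp
      then show ?thesis
        using f_expr_eq_num_overlattices_sorted[OF p, of b b "Suc b"]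
        by (simp add: c f_expr_swap23 f_expr_swap12 num_overlattices_swap23[of p b b] num_overlattices_swap12[of p b "Suc b"])
    qed
  qed
  show ?thesis
  proof (cases "b \<le> a")
    case True
    then show ?thesis using * assms by simp
  next
    case False
    then have "b = Suc a" using assms by simp
    then show ?thesis
      using *[of a "Suc a" c] assms by (simp add: f_expr_swap12 num_overlattices_swap12[of p a "Suc a"])
  qed
qed

section \<open>Moebius inversion\<close>

text \<open>Preimages in Z^3 of subspaces of F_p^3: \<open>plane\<close> takes the kernel of the
  linear form u, and \<open>line\<close> the span of d. Both contain p Z^3.\<close>

definition plane :: "nat \<Rightarrow> int \<times> int \<times> int \<Rightarrow> (int \<times> int \<times> int) set" where
  "plane p = (\<lambda>(u1, u2, u3). {(x, y, z). int p dvd u1 * x + u2 * y + u3 * z})"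

definition line :: "nat \<Rightarrow> int \<times> int \<times> int \<Rightarrow> (int \<times> int \<times> int) set" where
  "line p = (\<lambda>(d1, d2, d3). {(x, y, z). \<exists>k. int p dvd x - k * d1 \<and> int p dvd y - k * d2 \<and> int p dvd z - k * d3})"

lemma mem_plane [simp]:
  "(x, y, z) \<in> plane p (u1, u2, u3) \<longleftrightarrow> int p dvd u1 * x + u2 * y + u3 * z"
  by (simp add: plane_def)

lemma mem_line [simp]:
  "(x, y, z) \<in> line p (d1, d2, d3) \<longleftrightarrow> (\<exists>k. int p dvd x - k * d1 \<and> int p dvd y - k * d2 \<and> int p dvd z - k * d3)"
  by (simp add: line_def)

text \<open>Normalised representatives of the lines and of the planes of \<open>F\<^sub>p\<^sup>3\<close>. The normalisations are
  opposite so that a triangular change of coordinates moves each of them to a coordinate subspace.\<close>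

definition line_reps :: "nat \<Rightarrow> (int \<times> int \<times> int) set" where
  "line_reps p = {(0, 0, 1)} \<union> (\<lambda>t. (0, 1, t)) ` {0..<int p} \<union> (\<lambda>(s, t). (1, s, t)) ` ({0..<int p} \<times> {0..<int p})"

definition plane_reps :: "nat \<Rightarrow> (int \<times> int \<times> int) set" where
  "plane_reps p = {(1, 0, 0)} \<union> (\<lambda>s. (s, 1, 0)) ` {0..<int p} \<union> (\<lambda>(s, t). (s, t, 1)) ` ({0..<int p} \<times> {0..<int p})"

lemma finite_reps: "finite (line_reps p)" "finite (plane_reps p)"
  by (simp_all add: line_reps_def plane_reps_def)

text \<open>The three families, of sizes 1, p and p^2, stay separate because the sublattice count
  will be constant on each.\<close>

lemma sum_line_reps:
  "(\<Sum>d\<in>line_reps p. g d) = g (0, 0, 1) + (\<Sum>t\<in>{0..<int p}. g (0, 1, t))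
     + (\<Sum>s\<in>{0..<int p}. \<Sum>t\<in>{0..<int p}. g (1, s, t))"
  unfolding line_reps_def
  by (subst sum.union_disjoint; (force)?)+ (auto simp: sum.reindex inj_on_def sum.cartesian_product case_prod_unfold)

lemma sum_plane_reps:
  "(\<Sum>u\<in>plane_reps p. g u) = g (1, 0, 0) + (\<Sum>s\<in>{0..<int p}. g (s, 1, 0))
     + (\<Sum>s\<in>{0..<int p}. \<Sum>t\<in>{0..<int p}. g (s, t, 1))"
  unfolding plane_reps_def
  by (subst sum.union_disjoint; (force)?)+ (auto simp: sum.reindex inj_on_def sum.cartesian_product case_prod_unfold)

lemma card_line_reps: "card (line_reps p) = p\<^sup>2 + p + 1"
  and card_plane_reps: "card (plane_reps p) = p\<^sup>2 + p + 1"
  by (simp_all add: card_eq_sum sum_line_reps sum_plane_reps power2_eq_square del: sum_constant)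
     (simp_all add: power2_eq_square)

lemma subspace_plane: "Z3.subspace (plane p u)"
proof (cases u)
  case (fields u1 u2 u3)
  have add: "int p dvd u1 * (x + x') + u2 * (y + y') + u3 * (z + z')"
    if "int p dvd u1 * x + u2 * y + u3 * z" "int p dvd u1 * x' + u2 * y' + u3 * z'" for x y z x' y' z'
    using dvd_add[OF that] by (simp add: algebra_simps)
  have mult: "int p dvd u1 * (c * x) + u2 * (c * y) + u3 * (c * z)"
    if "int p dvd u1 * x + u2 * y + u3 * z" for c x y z
    using dvd_mult[OF that, of c] by (simp add: algebra_simps)
  show ?thesis
    unfolding Z3.subspace_def
  proof (intro conjI ballI allI)
    show "0 \<in> plane p u"
      by (simp add: fields zero_prod_def)
    show "v + w \<in> plane p u" if "v \<in> plane p u" "w \<in> plane p u" for v w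
      using that by (cases v; cases w; simp add: fields) (rule add)
    show "scale3 c v \<in> plane p u" if "v \<in> plane p u" for c v
      using that by (cases v; simp add: fields) (rule mult)
  qed
qed

lemma subspace_line: "Z3.subspace (line p d)"
proof (cases d)
  case (fields d1 d2 d3)
  have add: "int p dvd (x + x') - (k + k') * d" if "int p dvd x - k * d" "int p dvd x' - k' * d" for x x' k k' d
    using dvd_add[OF that] by (simp add: algebra_simps)
  have mult: "int p dvd c * x - (c * k) * d" if "int p dvd x - k * d" for x k c d
    using dvd_mult[OF that, of c] by (simp add: algebra_simps)
  show ?thesis
    unfolding Z3.subspace_def
  proof (intro conjI ballI allI)
    show "0 \<in> line p d"
      by (auto simp: fields zero_prod_def intro: exI[of _ 0])
    show "u + v \<in> line p d" if "u \<in> line p d" "v \<in> line p d" for u v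
      using that by (cases u; cases v; simp add: fields) (meson add)
    show "scale3 c v \<in> line p d" if "v \<in> line p d" for c v
      using that by (cases v; simp add: fields) (meson mult)
  qed
qed

lemma line_subset_plane:
  assumes "d \<in> plane p u"
  shows "line p d \<subseteq> plane p u"
proof clarify
  fix x y z assume v: "(x, y, z) \<in> line p d"
  obtain d1 d2 d3 where d: "d = (d1, d2, d3)" by (cases d)
  obtain u1 u2 u3 where u: "u = (u1, u2, u3)" by (cases u)
  obtain k where k: "int p dvd x - k * d1" "int p dvd y - k * d2" "int p dvd z - k * d3"
    using v by (auto simp: d)
  have du: "int p dvd u1 * d1 + u2 * d2 + u3 * d3"
    using assms by (simp add: u d)
  have "int p dvd k * (u1 * d1 + u2 * d2 + u3 * d3) + u1 * (x - k * d1) + u2 * (y - k * d2) + u3 * (z - k * d3)"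
    by (rule dvd_add[OF dvd_add[OF dvd_add[OF dvd_mult[OF du] dvd_mult[OF k(1)]] dvd_mult[OF k(2)]] dvd_mult[OF k(3)]])
  then show "(x, y, z) \<in> plane p u"
    by (simp add: u algebra_simps)
qed

lemma diag_lattice_1_subset_line: "diag_lattice p 1 1 1 \<subseteq> line p d"
  by (cases d) (auto simp: intro!: exI[of _ 0])

lemma diag_lattice_1_subset_plane: "diag_lattice p 1 1 1 \<subseteq> plane p u"
  by (cases u) auto

section \<open>Incidence of points and lines in the projective plane over F_p\<close>

context
  fixes p :: nat
  assumes p: "Factorial_Ring.prime p"
begin

lemma prime_dvd_mult_int: "int p dvd a * b \<longleftrightarrow> int p dvd a \<or> int p dvd b"
  using p by (simp add: prime_dvd_mult_iff)

lemma not_dvd_one: "\<not> int p dvd 1"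
  using prime_gt_1_nat[OF p] by simp

lemma inverse_mod:
  assumes "\<not> int p dvd k"
  obtains r where "int p dvd r * k - 1"
proof -
  have "coprime (int p) k"
    using p assms by (simp add: prime_imp_coprime)
  then obtain u v where "u * int p + v * k = 1"
    by (metis bezout_int coprime_iff_gcd_eq_1)
  then have "v * k - 1 = int p * (- u)"
    by (simp add: algebra_simps)
  then show ?thesis by (metis dvd_triv_left that)
qed

lemma residue_unique:
  assumes "s \<in> {0..<int p}"
  shows "int p dvd s + x \<longleftrightarrow> s = (- x) mod int p"
proof -
  have "int p dvd s + x \<longleftrightarrow> s mod int p = (- x) mod int p"
    by (simp add: mod_eq_dvd_iff)
  then show ?thesis using assms by simp
qed

lemma residue_cancel:
  assumes "s \<in> {0..<int p}" "t \<in> {0..<int p}"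
  shows "int p dvd s - t \<longleftrightarrow> s = t"
  using residue_unique[OF assms(1), of "- t"] assms(2) by simp

text \<open>A vanishing cross product means proportionality modulo p. If r inverts a coordinate of
  d, the factor is r times the same coordinate of (x, y, z).\<close>

lemma mem_line_cross:
  assumes d: "\<not> (int p dvd d1 \<and> int p dvd d2 \<and> int p dvd d3)"
    and c: "int p dvd d2 * z - d3 * y" "int p dvd d3 * x - d1 * z" "int p dvd d1 * y - d2 * x"
  shows "(x, y, z) \<in> line p (d1, d2, d3)"
proof -
  have *: "int p dvd v - (r * w) * f" if "int p dvd r * e - 1" "int p dvd e * v - f * w" for r e f v w
  proof -
    have "int p dvd r * (e * v - f * w) - (r * e - 1) * v"
      by (rule dvd_diff[OF dvd_mult[OF that(2)] dvd_mult2[OF that(1)]])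
    then show ?thesis by (simp add: algebra_simps)
  qed
  have c': "int p dvd d3 * y - d2 * z" "int p dvd d1 * z - d3 * x" "int p dvd d2 * x - d1 * y"
    using c by (simp_all add: dvd_diff_commute)
  have self: "int p dvd e * w - e * w" for e w by simp
  consider "\<not> int p dvd d1" | "\<not> int p dvd d2" | "\<not> int p dvd d3" using d by auto
  then show ?thesis
  proof cases
    case 1
    then obtain r where r: "int p dvd r * d1 - 1" by (rule inverse_mod)
    show ?thesis
      using *[OF r self] *[OF r c(3)] *[OF r c'(2)] by auto
  next
    case 2
    then obtain r where r: "int p dvd r * d2 - 1" by (rule inverse_mod)
    show ?thesis
      using *[OF r self] *[OF r c(1)] *[OF r c'(3)] by auto
  next
    case 3
    then obtain r where r: "int p dvd r * d3 - 1" by (rule inverse_mod)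
    show ?thesis
      using *[OF r self] *[OF r c(2)] *[OF r c'(1)] by auto
  qed
qed

text \<open>Proportional normalised vectors agree, since the coordinate normalised to 1 fixes the
  factor.\<close>

lemma cross_plane_reps:
  assumes "(a1, a2, a3) \<in> plane_reps p" "(b1, b2, b3) \<in> plane_reps p"
    and "int p dvd a2 * b3 - a3 * b2" "int p dvd a3 * b1 - a1 * b3" "int p dvd a1 * b2 - a2 * b1"
  shows "(a1, a2, a3) = (b1, b2, b3)"
  using assms not_dvd_one by (auto simp: plane_reps_def residue_cancel)

lemma cross_line_reps:
  assumes "(a1, a2, a3) \<in> line_reps p" "(b1, b2, b3) \<in> line_reps p"
    and "int p dvd a2 * b3 - a3 * b2" "int p dvd a3 * b1 - a1 * b3" "int p dvd a1 * b2 - a2 * b1"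
  shows "(a1, a2, a3) = (b1, b2, b3)"
  using assms not_dvd_one by (auto simp: line_reps_def residue_cancel)

text \<open>Divide d modulo p by its first coordinate that is nonzero modulo p.\<close>

lemma line_subset_normalised:
  assumes d: "\<not> (int p dvd d1 \<and> int p dvd d2 \<and> int p dvd d3)"
  obtains d' where "d' \<in> line_reps p" "line p (d1, d2, d3) \<subseteq> line p d'"
proof -
  have p0: "int p > 0" using prime_gt_0_nat[OF p] by simp
  have *: "int p dvd x - (k * e) * ((r * f) mod int p)" if "int p dvd r * e - 1" "int p dvd x - k * f" for x k e r f
  proof -
    have "int p dvd (x - k * f) + (k * e) * (r * f - (r * f) mod int p) - k * f * (r * e - 1)"
      by (rule dvd_diff[OF dvd_add[OF that(2) dvd_mult[OF dvd_minus_mod]] dvd_mult[OF that(1)]])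
    then show ?thesis by (simp add: algebra_simps)
  qed
  have **: "int p dvd x" if "int p dvd x - k * f" "int p dvd f" for x k f
    using dvd_add[OF that(1) dvd_mult[OF that(2), of k]] by simp
  consider "\<not> int p dvd d1" | "int p dvd d1" "\<not> int p dvd d2" | "int p dvd d1" "int p dvd d2" "\<not> int p dvd d3"
    using d by auto
  then show ?thesis
  proof cases
    case 1
    then obtain r where r: "int p dvd r * d1 - 1" by (rule inverse_mod)
    show ?thesis
    proof (rule that)
      show "(1, (r * d2) mod int p, (r * d3) mod int p) \<in> line_reps p"
        using p0 by (auto simp: line_reps_def)
      show "line p (d1, d2, d3) \<subseteq> line p (1, (r * d2) mod int p, (r * d3) mod int p)"
        using *[OF r] by auto (metis mult.right_neutral)
    qed
  next
    case 2
    from 2(2) obtain r where r: "int p dvd r * d2 - 1" by (rule inverse_mod)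
    show ?thesis
    proof (rule that)
      show "(0, 1, (r * d3) mod int p) \<in> line_reps p"
        using p0 by (auto simp: line_reps_def)
      show "line p (d1, d2, d3) \<subseteq> line p (0, 1, (r * d3) mod int p)"
      proof clarify
        fix x y z assume "(x, y, z) \<in> line p (d1, d2, d3)"
        then obtain k where k: "int p dvd x - k * d1" "int p dvd y - k * d2" "int p dvd z - k * d3"
          by auto
        have "int p dvd x - (k * d2) * 0"
          using **[OF k(1) 2(1)] by simp
        moreover have "int p dvd y - (k * d2) * 1"
          using k(2) by simp
        ultimately show "(x, y, z) \<in> line p (0, 1, (r * d3) mod int p)"
          using *[OF r k(3)] unfolding mem_line by blast
      qed
    qed
  next
    case 3
    show ?thesis
    proof (rule that)
      show "(0, 0, 1) \<in> line_reps p"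
        by (auto simp: line_reps_def)
      show "line p (d1, d2, d3) \<subseteq> line p (0, 0, 1)"
      proof clarify
        fix x y z assume "(x, y, z) \<in> line p (d1, d2, d3)"
        then obtain k where "int p dvd x - k * d1" "int p dvd y - k * d2"
          by auto
        then have "int p dvd x" "int p dvd y"
          using ** 3 by blast+
        then show "(x, y, z) \<in> line p (0, 0, 1)"
          by (auto intro: exI[of _ z])
      qed
    qed
  qed
qed

text \<open>Divide the linear form modulo p by its last coordinate that is nonzero modulo p.\<close>

lemma plane_subset_normalised:
  assumes u: "\<not> (int p dvd u1 \<and> int p dvd u2 \<and> int p dvd u3)"
  obtains u' where "u' \<in> plane_reps p" "plane p (u1, u2, u3) \<subseteq> plane p u'"
proof -
  have p0: "int p > 0" using prime_gt_0_nat[OF p] by simp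
  have m: "int p dvd (r * u) mod int p - r * u" for r u
    by (simp add: mod_eq_dvd_iff[symmetric])
  consider "\<not> int p dvd u3" | "int p dvd u3" "\<not> int p dvd u2" | "int p dvd u3" "int p dvd u2" "\<not> int p dvd u1"
    using u by auto
  then show ?thesis
  proof cases
    case 1
    then obtain r where r: "int p dvd r * u3 - 1" by (rule inverse_mod)
    show ?thesis
    proof (rule that)
      show "((r * u1) mod int p, (r * u2) mod int p, 1) \<in> plane_reps p"
        using p0 by (auto simp: plane_reps_def)
      have "int p dvd (r * u1) mod int p * x + (r * u2) mod int p * y + z"
        if "int p dvd u1 * x + u2 * y + u3 * z" for x y z
      proof -
        have "int p dvd r * (u1 * x + u2 * y + u3 * z) + ((r * u1) mod int p - r * u1) * x
            + ((r * u2) mod int p - r * u2) * y - (r * u3 - 1) * z"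
          by (rule dvd_diff[OF dvd_add[OF dvd_add[OF dvd_mult[OF that] dvd_mult2[OF m]] dvd_mult2[OF m]] dvd_mult2[OF r]])
        then show ?thesis by (simp add: algebra_simps)
      qed
      then show "plane p (u1, u2, u3) \<subseteq> plane p ((r * u1) mod int p, (r * u2) mod int p, 1)"
        by auto
    qed
  next
    case 2
    then obtain r where r: "int p dvd r * u2 - 1" using inverse_mod by blast
    show ?thesis
    proof (rule that)
      show "((r * u1) mod int p, 1, 0) \<in> plane_reps p"
        using p0 by (auto simp: plane_reps_def)
      have "int p dvd (r * u1) mod int p * x + y"
        if "int p dvd u1 * x + u2 * y + u3 * z" for x y z
      proof -
        have "int p dvd r * (u1 * x + u2 * y + u3 * z) + ((r * u1) mod int p - r * u1) * x
            - (r * u2 - 1) * y - r * (u3 * z)"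
          by (rule dvd_diff[OF dvd_diff[OF dvd_add[OF dvd_mult[OF that] dvd_mult2[OF m]] dvd_mult2[OF r]]
                dvd_mult[OF dvd_mult2[OF 2(1)]]])
        then show ?thesis by (simp add: algebra_simps)
      qed
      then show "plane p (u1, u2, u3) \<subseteq> plane p ((r * u1) mod int p, 1, 0)"
        by auto
    qed
  next
    case 3
    then obtain r where r: "int p dvd r * u1 - 1" using inverse_mod by blast
    show ?thesis
    proof (rule that)
      show "(1, 0, 0) \<in> plane_reps p"
        by (auto simp: plane_reps_def)
      have "int p dvd x"
        if "int p dvd u1 * x + u2 * y + u3 * z" for x y z
      proof -
        have "int p dvd r * (u1 * x + u2 * y + u3 * z) - (r * u1 - 1) * x - r * (u2 * y) - r * (u3 * z)"
          by (rule dvd_diff[OF dvd_diff[OF dvd_diff[OF dvd_mult[OF that] dvd_mult2[OF r]]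
                dvd_mult[OF dvd_mult2[OF 3(2)]]] dvd_mult[OF dvd_mult2[OF 3(1)]]])
        then show ?thesis by (simp add: algebra_simps)
      qed
      then show "plane p (u1, u2, u3) \<subseteq> plane p (1, 0, 0)"
        by (clarify, unfold mem_plane mult_1 mult_zero_left add_0_right)
    qed
  qed
qed

text \<open>Two distinct planes meet in the line spanned by the cross product of their normal
  vectors.\<close>

lemma Int_planes_subset_line:
  assumes u: "u \<in> plane_reps p" "u' \<in> plane_reps p" "u \<noteq> u'"
  obtains d where "d \<in> line_reps p" "plane p u \<inter> plane p u' \<subseteq> line p d"
proof -
  obtain a1 a2 a3 where a: "u = (a1, a2, a3)" by (cases u)
  obtain b1 b2 b3 where b: "u' = (b1, b2, b3)" by (cases u')
  let ?d1 = "a2 * b3 - a3 * b2" and ?d2 = "a3 * b1 - a1 * b3" and ?d3 = "a1 * b2 - a2 * b1"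
  have nz: "\<not> (int p dvd ?d1 \<and> int p dvd ?d2 \<and> int p dvd ?d3)"
    using cross_plane_reps[of a1 a2 a3 b1 b2 b3] u unfolding a b by argo
  have "(x, y, z) \<in> line p (?d1, ?d2, ?d3)"
    if A: "int p dvd a1 * x + a2 * y + a3 * z" and B: "int p dvd b1 * x + b2 * y + b3 * z" for x y z
  proof (rule mem_line_cross[OF nz])
    \<comment> \<open>By the identity (a x b) x v = b (a.v) - a (b.v), suitable s and t give the
      three components of the double cross product.\<close>
    have C: "int p dvd s * (a1 * x + a2 * y + a3 * z) - t * (b1 * x + b2 * y + b3 * z)" for s t
      by (rule dvd_diff[OF dvd_mult[OF A] dvd_mult[OF B]])
    show "int p dvd ?d2 * z - ?d3 * y" using C[of b1 a1] by (simp add: algebra_simps)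
    show "int p dvd ?d3 * x - ?d1 * z" using C[of b2 a2] by (simp add: algebra_simps)
    show "int p dvd ?d1 * y - ?d2 * x" using C[of b3 a3] by (simp add: algebra_simps)
  qed
  then have "plane p u \<inter> plane p u' \<subseteq> line p (?d1, ?d2, ?d3)"
    by (auto simp: a b)
  then show ?thesis
    using line_subset_normalised[OF nz] that by (metis order_trans)
qed

lemma line_mult_not_dvd:
  assumes "(x, y, z) \<notin> diag_lattice p 1 1 1" "int p dvd x - k * d1" "int p dvd y - k * d2" "int p dvd z - k * d3"
  shows "\<not> int p dvd k"
proof
  assume k: "int p dvd k"
  have "int p dvd k * d1 + (x - k * d1)" "int p dvd k * d2 + (y - k * d2)" "int p dvd k * d3 + (z - k * d3)"
    by (rule dvd_add[OF dvd_mult2[OF k]], rule assms)+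
  then show False using assms by simp
qed

text \<open>A vector that is nonzero modulo p spans a single line: if it is k d and l d' modulo p,
  then d and d' are proportional.\<close>

lemma line_unique:
  assumes w: "w \<in> line p d" "w \<in> line p d'" "w \<notin> diag_lattice p 1 1 1"
    and d: "d \<in> line_reps p" "d' \<in> line_reps p"
  shows "d = d'"
proof -
  obtain x y z where xyz: "w = (x, y, z)" by (cases w)
  obtain a1 a2 a3 where a: "d = (a1, a2, a3)" by (cases d)
  obtain b1 b2 b3 where b: "d' = (b1, b2, b3)" by (cases d')
  obtain k where k: "int p dvd x - k * a1" "int p dvd y - k * a2" "int p dvd z - k * a3"
    using w by (auto simp: xyz a)
  obtain l where l: "int p dvd x - l * b1" "int p dvd y - l * b2" "int p dvd z - l * b3"
    using w by (auto simp: xyz b)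
  have kl: "\<not> int p dvd k" "\<not> int p dvd l"
    using line_mult_not_dvd k l w(3) unfolding xyz by blast+
  have *: "int p dvd e * f' - f * e'"
    if "int p dvd v - k * e" "int p dvd w - k * f" "int p dvd v - l * e'" "int p dvd w - l * f'" for v w e f e' f'
  proof -
    \<comment> \<open>Modulo p the product v w equals both k e l f' and l e' k f; then k and l
      cancel.\<close>
    have "int p dvd w * (v - l * e') + l * e' * (w - k * f) - v * (w - l * f') - l * f' * (v - k * e)"
      by (rule dvd_diff[OF dvd_diff[OF dvd_add[OF dvd_mult[OF that(3)] dvd_mult[OF that(2)]] dvd_mult[OF that(4)]] dvd_mult[OF that(1)]])
    then have "int p dvd (k * l) * (e * f' - f * e')"
      by (simp add: algebra_simps)
    then show ?thesis using kl by (simp add: prime_dvd_mult_int)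
  qed
  show ?thesis
    unfolding a b
    by (rule cross_line_reps) (use d a b *[OF k(2,3) l(2,3)] *[OF k(3,1) l(3,1)] *[OF k(1,2) l(1,2)] in auto)
qed

text \<open>The form takes the value k u.d at w modulo p, where k is invertible.\<close>

lemma mem_plane_of_line:
  assumes w: "w \<in> line p d" "w \<notin> diag_lattice p 1 1 1" "w \<in> plane p u"
  shows "d \<in> plane p u"
proof -
  obtain x y z where xyz: "w = (x, y, z)" by (cases w)
  obtain d1 d2 d3 where d: "d = (d1, d2, d3)" by (cases d)
  obtain u1 u2 u3 where u: "u = (u1, u2, u3)" by (cases u)
  obtain k where k: "int p dvd x - k * d1" "int p dvd y - k * d2" "int p dvd z - k * d3"
    using w by (auto simp: xyz d)
  have nk: "\<not> int p dvd k"
    using line_mult_not_dvd k w(2) unfolding xyz by blast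
  have "int p dvd (u1 * x + u2 * y + u3 * z) - u1 * (x - k * d1) - u2 * (y - k * d2) - u3 * (z - k * d3)"
    using w(3) by (intro dvd_diff[OF dvd_diff[OF dvd_diff[OF _ dvd_mult[OF k(1)]] dvd_mult[OF k(2)]] dvd_mult[OF k(3)]])
      (simp add: xyz u)
  then have "int p dvd k * (u1 * d1 + u2 * d2 + u3 * d3)"
    by (simp add: algebra_simps)
  then show ?thesis using nk by (simp add: prime_dvd_mult_int d u)
qed

text \<open>For each normal form of d, the incidence condition is solved for one coordinate of u,
  which leaves one exceptional plane and a family of p planes.\<close>

lemma card_planes_through_line:
  assumes "d \<in> line_reps p"
  shows "card {u \<in> plane_reps p. d \<in> plane p u} = p + 1"
proof -
  let ?I = "{0..<int p}"
  have p0: "int p > 0" using prime_gt_0_nat[OF p] by simp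
  have mod_I: "x mod int p \<in> ?I" for x using p0 by simp
  consider "d = (0, 0, 1)" | t where "d = (0, 1, t)" | s t where "d = (1, s, t)"
    using assms by (auto simp: line_reps_def)
  then show ?thesis
  proof cases
    case 1
    then have "{u \<in> plane_reps p. d \<in> plane p u} = insert (1, 0, 0) ((\<lambda>s. (s, 1, 0)) ` ?I)"
      using not_dvd_one by (auto simp: plane_reps_def)
    moreover have "card \<dots> = p + 1"
      by (subst card_insert_disjoint) (auto simp: card_image inj_on_def)
    ultimately show ?thesis by simp
  next
    case (2 t)
    then have "{u \<in> plane_reps p. d \<in> plane p u} = insert (1, 0, 0) ((\<lambda>s. (s, (- t) mod int p, 1)) ` ?I)"
      using not_dvd_one mod_I[of "- t"] residue_unique[of _ t] by (auto simp: plane_reps_def)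
    moreover have "card \<dots> = p + 1"
      by (subst card_insert_disjoint) (auto simp: card_image inj_on_def)
    ultimately show ?thesis by simp
  next
    case (3 s t)
    then have "{u \<in> plane_reps p. d \<in> plane p u}
        = insert ((- s) mod int p, 1, 0) ((\<lambda>r. ((- (r * s + t)) mod int p, r, 1)) ` ?I)"
      using not_dvd_one mod_I residue_unique[of _ s] residue_unique
      by (auto simp: plane_reps_def add.assoc)
    moreover have "card \<dots> = p + 1"
      by (subst card_insert_disjoint) (auto simp: card_image inj_on_def)
    ultimately show ?thesis by simp
  qed
qed

lemma power_scale_mem_diag_lattice: "\<exists>n. scale3 (int p ^ n) v \<in> diag_lattice p a b c"
proof (cases v)
  case (fields x y z)
  show ?thesis
    by (rule exI[of _ "a + b + c"]) (simp add: fields power_add)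
qed

text \<open>A maximal proper M containing J has quotient of order p generated by g, so M is the
  kernel of a linear form modulo p.\<close>

lemma proper_subset_plane:
  assumes J: "J \<in> Z3.overlattices (diag_lattice p a b c)" "J \<noteq> UNIV"
  obtains u where "u \<in> plane_reps p" "J \<subseteq> plane p u"
proof -
  interpret prime_int_module scale3 p
    by unfold_locales (rule p)
  obtain M g where M: "M \<in> Z3.overlattices J" and g: "g \<notin> M" "scale3 (int p) g \<in> M"
    and span: "Z3.span (insert g M) = UNIV"
    by (rule exists_maximal_overlattice[OF subspace_diag_lattice finite_quotient_diag_lattice power_scale_mem_diag_lattice J])
      (use prime_gt_0_nat[OF p] in auto)
  have sM: "Z3.subspace M" and JM: "J \<subseteq> M"
    using M by (auto simp: Z3.overlattices_def)
  have "\<exists>k. v - scale3 k g \<in> M" for v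
    using Z3.mem_span_insert_subspace[OF sM, of v g] span by simp
  then obtain k where k: "\<And>v. v - scale3 (k v) g \<in> M" by metis
  \<comment> \<open>The values of that form at the unit vectors, read off as multiples of g modulo
    M.\<close>
  define k1 k2 k3 where "k1 = k (1, 0, 0)" "k2 = k (0, 1, 0)" "k3 = k (0, 0, 1)"
  have mem: "(x, y, z) \<in> M \<longleftrightarrow> int p dvd k1 * x + k2 * y + k3 * z" for x y z
  proof -
    have "scale3 x ((1, 0, 0) - scale3 k1 g) + scale3 y ((0, 1, 0) - scale3 k2 g)
        + scale3 z ((0, 0, 1) - scale3 k3 g) \<in> M"
      using k unfolding k1_k2_k3_def by (intro Z3.subspace_add[OF sM] Z3.subspace_scale[OF sM]) auto
    moreover have "scale3 x ((1, 0, 0) - scale3 k1 g) + scale3 y ((0, 1, 0) - scale3 k2 g)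
        + scale3 z ((0, 0, 1) - scale3 k3 g) = (x, y, z) - scale3 (k1 * x + k2 * y + k3 * z) g"
      by (cases g) (simp add: algebra_simps)
    ultimately have *: "(x, y, z) - scale3 (k1 * x + k2 * y + k3 * z) g \<in> M" by simp
    let ?w = "scale3 (k1 * x + k2 * y + k3 * z) g"
    have "?w \<in> M" if "(x, y, z) \<in> M"
      using Z3.subspace_diff[OF sM that *] by simp
    moreover have "(x, y, z) \<in> M" if "?w \<in> M"
      using Z3.subspace_add[OF sM * that] by simp
    ultimately have "(x, y, z) \<in> M \<longleftrightarrow> ?w \<in> M"
      by blast
    then show ?thesis
      using scale_mem_iff[OF sM g] by simp
  qed
  have "\<not> (int p dvd k1 \<and> int p dvd k2 \<and> int p dvd k3)"
    using g(1) mem by (cases g) auto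
  then obtain u where u: "u \<in> plane_reps p" "plane p (k1, k2, k3) \<subseteq> plane p u"
    by (rule plane_subset_normalised)
  have "J \<subseteq> plane p (k1, k2, k3)"
    using JM mem by auto
  with u show ?thesis by (intro that[of u]) auto
qed

lemma plane_not_supset_UNIV:
  assumes "u \<in> plane_reps p"
  shows "\<not> UNIV \<subseteq> plane p u"
proof
  assume U: "UNIV \<subseteq> plane p u"
  then have "(1, 0, 0) \<in> plane p u" "(0, 1, 0) \<in> plane p u" "(0, 0, 1) \<in> plane p u"
    using U by auto
  then show False
    using assms not_dvd_one by (auto simp: plane_reps_def)
qed

lemma line_not_supset_UNIV:
  assumes "d \<in> line_reps p"
  shows "\<not> UNIV \<subseteq> line p d"
proof
  assume U: "UNIV \<subseteq> line p d"
  have "{u \<in> plane_reps p. d \<in> plane p u} \<noteq> {}"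
    using card_planes_through_line[OF assms] by (metis Suc_eq_plus1 card.empty nat.distinct(1))
  then obtain u where "u \<in> plane_reps p" "d \<in> plane p u" by auto
  then show False
    using U line_subset_plane[of d p u] plane_not_supset_UNIV[of u] by blast
qed

text \<open>The coefficients \<open>1, -1, p, -p\<^sup>3\<close> are the values of the Moebius function of the lattice of
  subspaces of \<open>F\<^sub>p\<^sup>3\<close>.\<close>

lemma moebius_identity:
  assumes J: "J \<in> Z3.overlattices (diag_lattice p a b c)"
  shows "of_bool (J = UNIV) = 1 - int (card {u \<in> plane_reps p. J \<subseteq> plane p u})
    + int p * int (card {d \<in> line_reps p. J \<subseteq> line p d}) - int p ^ 3 * of_bool (J \<subseteq> diag_lattice p 1 1 1)"
proof -
  \<comment> \<open>The cases are those where the image of J in F_p^3 has dimension 3, 0, 1 and 2,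
    in this order.\<close>
  consider "J = UNIV" | "J \<subseteq> diag_lattice p 1 1 1" | d where "\<not> J \<subseteq> diag_lattice p 1 1 1" "d \<in> line_reps p" "J \<subseteq> line p d"
    | "J \<noteq> UNIV" "\<not> (\<exists>d\<in>line_reps p. J \<subseteq> line p d)" "\<not> J \<subseteq> diag_lattice p 1 1 1"
    by blast
  then show ?thesis
  proof cases
    case 1
    have e: "{u \<in> plane_reps p. J \<subseteq> plane p u} = {}" "{d \<in> line_reps p. J \<subseteq> line p d} = {}"
      using plane_not_supset_UNIV line_not_supset_UNIV 1 by auto
     have "(1, 1, 1) \<notin> diag_lattice p 1 1 1" using not_dvd_one by simp
    then have "\<not> J \<subseteq> diag_lattice p 1 1 1" using 1 by blast
    then show ?thesis unfolding e using 1 by simp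
  next
    case 2
    have "{u \<in> plane_reps p. J \<subseteq> plane p u} = plane_reps p" "{d \<in> line_reps p. J \<subseteq> line p d} = line_reps p"
      using 2 diag_lattice_1_subset_plane diag_lattice_1_subset_line by (blast+)
    moreover have "(1, 1, 1) \<notin> diag_lattice p 1 1 1" using not_dvd_one by simp
    then have "J \<noteq> UNIV" using 2 by blast
    ultimately show ?thesis
      using 2 by (simp add: card_line_reps card_plane_reps algebra_simps power2_eq_square power3_eq_cube)
  next
    case (3 d)
    then obtain w where w: "w \<in> J" "w \<notin> diag_lattice p 1 1 1" by auto
    have "{d \<in> line_reps p. J \<subseteq> line p d} = {d}"
      using line_unique[of w] 3 w by blast
    moreover have "J \<subseteq> plane p u \<longleftrightarrow> d \<in> plane p u" for u
      using mem_plane_of_line[of w d u] line_subset_plane[of d p u] 3 w by blast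
    moreover have "J \<noteq> UNIV" using 3 line_not_supset_UNIV[of d] by auto
    ultimately show ?thesis
      using 3 card_planes_through_line[of d] by simp
  next
    case 4
    obtain u where u: "u \<in> plane_reps p" "J \<subseteq> plane p u"
      using proper_subset_plane[OF J 4(1)] .
    have "u' = u" if u': "u' \<in> plane_reps p" "J \<subseteq> plane p u'" for u'
    proof (rule ccontr)
      assume "u' \<noteq> u"
      then obtain d where "d \<in> line_reps p" "plane p u' \<inter> plane p u \<subseteq> line p d"
        using Int_planes_subset_line[OF u'(1) u(1)] by blast
      then show False using 4 u u' by blast
    qed
    then have "{u \<in> plane_reps p. J \<subseteq> plane p u} = {u}"
      using u by blast
    moreover have e: "{d \<in> line_reps p. J \<subseteq> line p d} = {}"
      using 4 by blast
    ultimately show ?thesis unfolding e using 4 by simp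
  qed
qed

end

section \<open>Maximal lattices as images of triangular maps\<close>

definition sublattice_count :: "nat \<Rightarrow> nat \<Rightarrow> nat \<Rightarrow> nat \<Rightarrow> (int \<times> int \<times> int) set \<Rightarrow> nat" where
  "sublattice_count p a b c K = card {L \<in> Z3.overlattices (diag_lattice p a b c). L \<subseteq> K}"

text \<open>The triangular map is injective with image K. The divisibility conditions make it carry
  the lattice with exponents a, b, c onto the one with exponents a + i, b + j, c + k, so lattices
  inside K correspond to all overlattices of the former.\<close>

lemma sublattice_count_triangular:
  assumes p0: "p > 0" and s: "int p ^ (b + j) dvd s * int p ^ a"
    and t: "int p ^ (c + k) dvd t * int p ^ a" and w: "int p ^ (c + k) dvd w * int p ^ b"
    and K: "K = range (\<lambda>(x, y, z). (int p ^ i * x, int p ^ j * y + s * x, int p ^ k * z + t * x + w * y))"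
  shows "sublattice_count p (a + i) (b + j) (c + k) K = num_overlattices p a b c"
proof -
  let ?T = "\<lambda>(x, y, z). (int p ^ i * x, int p ^ j * y + s * x, int p ^ k * z + t * x + w * y)"
  have T: "module_hom scale3 scale3 ?T"
    by (rule module_homI3) (auto simp: algebra_simps)
  have inj: "inj ?T"
    using p0 by (auto simp: inj_def)
  have "?T ` diag_lattice p a b c = diag_lattice p (a + i) (b + j) (c + k)"
  proof (intro equalityI subsetI)
    fix v assume "v \<in> ?T ` diag_lattice p a b c"
    then obtain V where V: "v = ?T V" "V \<in> diag_lattice p a b c"
      by blast
    obtain X Y Z where "V = (X, Y, Z)" by (cases V)
    with V have XYZ: "v = ?T (X, Y, Z)" "int p ^ a dvd X" "int p ^ b dvd Y" "int p ^ c dvd Z"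
      by auto
    from XYZ(2-4) obtain x y z where "X = int p ^ a * x" "Y = int p ^ b * y" "Z = int p ^ c * z"
      by (elim dvdE)
    with XYZ have v: "v = ?T (int p ^ a * x, int p ^ b * y, int p ^ c * z)"
      by simp
    have "int p ^ (b + j) dvd int p ^ j * (int p ^ b * y) + s * int p ^ a * x"
      by (rule dvd_add[OF _ dvd_mult2[OF s]]) (simp add: power_add mult_ac)
    moreover have "int p ^ (c + k) dvd int p ^ k * (int p ^ c * z) + t * int p ^ a * x + w * int p ^ b * y"
      by (rule dvd_add[OF dvd_add[OF _ dvd_mult2[OF t]] dvd_mult2[OF w]]) (simp add: power_add mult_ac)
    ultimately show "v \<in> diag_lattice p (a + i) (b + j) (c + k)"
      by (simp add: v power_add mult_ac)
  next
    fix v assume v: "v \<in> diag_lattice p (a + i) (b + j) (c + k)"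
    obtain X Y Z where XYZ: "v = (X, Y, Z)" by (cases v)
    obtain x where x: "X = int p ^ (a + i) * x" using v XYZ by auto
    have "int p ^ (b + j) dvd Y - s * int p ^ a * x"
      using v XYZ dvd_mult2[OF s, of x] by simp
    then obtain y where "Y - s * int p ^ a * x = int p ^ (b + j) * y" by (elim dvdE)
    then have y: "Y = int p ^ (b + j) * y + s * int p ^ a * x" by simp
    have "int p ^ (c + k) dvd Z - t * int p ^ a * x - w * int p ^ b * y"
      using v XYZ dvd_mult2[OF t, of x] dvd_mult2[OF w, of y] by simp
    then obtain z where "Z - t * int p ^ a * x - w * int p ^ b * y = int p ^ (c + k) * z" by (elim dvdE)
    then have z: "Z = int p ^ (c + k) * z + t * int p ^ a * x + w * int p ^ b * y" by simp
    have "v = ?T (int p ^ a * x, int p ^ b * y, int p ^ c * z)"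
      by (simp add: XYZ x y z power_add mult_ac)
    then show "v \<in> ?T ` diag_lattice p a b c"
      by (rule image_eqI) simp
  qed
  then have "bij_betw ((`) ?T) (Z3.overlattices (diag_lattice p a b c))
      {L \<in> Z3.overlattices (diag_lattice p (a + i) (b + j) (c + k)). L \<subseteq> K}"
    using Z3.bij_betw_image_overlattices[OF T inj, of "diag_lattice p a b c" UNIV] by (simp add: K)
  then show ?thesis
    by (simp add: sublattice_count_def num_overlattices_def bij_betw_same_card)
qed

lemma eq_range3:
  assumes "\<And>x y z. T (x, y, z) \<in> K" "\<And>x y z. (x, y, z) \<in> K \<Longrightarrow> (x, y, z) \<in> range T"
  shows "K = range T"
  using assms by (auto simp: image_iff)

lemma sublattice_count_diag_lattice_1:
  assumes "p > 0"
  shows "sublattice_count p (Suc a) (Suc b) (Suc c) (diag_lattice p 1 1 1) = num_overlattices p a b c"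
proof -
  have "diag_lattice p 1 1 1 = range (\<lambda>(x, y, z). (int p ^ 1 * x, int p ^ 1 * y + 0 * x, int p ^ 1 * z + 0 * x + 0 * y))"
  proof (rule eq_range3)
    fix x y z assume "(x, y, z) \<in> diag_lattice p 1 1 1"
    then obtain x' y' z' where "x = int p * x'" "y = int p * y'" "z = int p * z'"
      by (auto elim!: dvdE)
    then show "(x, y, z) \<in> range (\<lambda>(x, y, z). (int p ^ 1 * x, int p ^ 1 * y + 0 * x, int p ^ 1 * z + 0 * x + 0 * y))"
      by (intro image_eqI[of _ _ "(x', y', z')"]) auto
  qed auto
  then show ?thesis
    using sublattice_count_triangular[OF assms, of b 1 0 a c 1 0 0 _ 1] by simp
qed

lemma sublattice_count_plane1:
  assumes "p > 0" "c \<le> b" "b \<le> a"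
  shows "sublattice_count p (Suc a) (Suc b) (Suc c) (plane p (1, 0, 0)) = num_overlattices p a (Suc b) (Suc c)"
proof -
  have "plane p (1, 0, 0) = range (\<lambda>(x, y, z). (int p ^ 1 * x, int p ^ 0 * y + 0 * x, int p ^ 0 * z + 0 * x + 0 * y))"
  proof (rule eq_range3)
    show "(\<lambda>(x, y, z). (int p ^ 1 * x, int p ^ 0 * y + 0 * x, int p ^ 0 * z + 0 * x + 0 * y)) (x, y, z) \<in> plane p (1, 0, 0)" for x y z
      by auto
  next
    fix x y z assume "(x, y, z) \<in> plane p (1, 0, 0)"
    then obtain x' where "x = int p * x'"
      by (auto elim!: dvdE)
    then show "(x, y, z) \<in> range (\<lambda>(x, y, z). (int p ^ 1 * x, int p ^ 0 * y + 0 * x, int p ^ 0 * z + 0 * x + 0 * y))"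
      by (intro image_eqI[of _ _ "(x', y, z)"]) (auto simp: algebra_simps)
  qed
  then show ?thesis
    using sublattice_count_triangular[of p "(Suc b)" 0 "0" "a" "(Suc c)" 0 "0" "0" "plane p (1, 0, 0)" 1] assms
    by (simp add: le_imp_power_dvd dvd_mult del: power_Suc)
qed

text \<open>The plane equation is solved for y. The off-diagonal entry -s sends the first coordinate
  to the second, which is compatible with the moduli because b is at most a.\<close>

lemma sublattice_count_plane2:
  assumes "p > 0" "c \<le> b" "b \<le> a"
  shows "sublattice_count p (Suc a) (Suc b) (Suc c) (plane p (s, 1, 0)) = num_overlattices p (Suc a) b (Suc c)"
proof -
  have "plane p (s, 1, 0) = range (\<lambda>(x, y, z). (int p ^ 0 * x, int p ^ 1 * y + (- s) * x, int p ^ 0 * z + 0 * x + 0 * y))"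
  proof (rule eq_range3)
    show "(\<lambda>(x, y, z). (int p ^ 0 * x, int p ^ 1 * y + (- s) * x, int p ^ 0 * z + 0 * x + 0 * y)) (x, y, z) \<in> plane p (s, 1, 0)" for x y z
      by auto
  next
    fix x y z assume "(x, y, z) \<in> plane p (s, 1, 0)"
    then have "int p dvd s * x + y"
      by simp
    then obtain y' where "s * x + y = int p * y'"
      by (elim dvdE)
    then have "y = int p * y' - s * x"
      by simp
    then show "(x, y, z) \<in> range (\<lambda>(x, y, z). (int p ^ 0 * x, int p ^ 1 * y + (- s) * x, int p ^ 0 * z + 0 * x + 0 * y))"
      by (intro image_eqI[of _ _ "(x, y', z)"]) (auto simp: algebra_simps)
  qed
  then show ?thesis
    using sublattice_count_triangular[of p "b" 1 "(- s)" "(Suc a)" "(Suc c)" 0 "0" "0" "plane p (s, 1, 0)" 0] assms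
    by (simp add: le_imp_power_dvd dvd_mult del: power_Suc)
qed

lemma sublattice_count_plane3:
  assumes "p > 0" "c \<le> b" "b \<le> a"
  shows "sublattice_count p (Suc a) (Suc b) (Suc c) (plane p (s, t, 1)) = num_overlattices p (Suc a) (Suc b) c"
proof -
  have "plane p (s, t, 1) = range (\<lambda>(x, y, z). (int p ^ 0 * x, int p ^ 0 * y + 0 * x, int p ^ 1 * z + (- s) * x + (- t) * y))"
  proof (rule eq_range3)
    show "(\<lambda>(x, y, z). (int p ^ 0 * x, int p ^ 0 * y + 0 * x, int p ^ 1 * z + (- s) * x + (- t) * y)) (x, y, z) \<in> plane p (s, t, 1)" for x y z
      by auto
  next
    fix x y z assume "(x, y, z) \<in> plane p (s, t, 1)"
    then have "int p dvd s * x + t * y + z"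
      by simp
    then obtain z' where "s * x + t * y + z = int p * z'"
      by (elim dvdE)
    then have "z = int p * z' - s * x - t * y"
      by simp
    then show "(x, y, z) \<in> range (\<lambda>(x, y, z). (int p ^ 0 * x, int p ^ 0 * y + 0 * x, int p ^ 1 * z + (- s) * x + (- t) * y))"
      by (intro image_eqI[of _ _ "(x, y, z')"]) (auto simp: algebra_simps)
  qed
  then show ?thesis
    using sublattice_count_triangular[of p "(Suc b)" 0 "0" "(Suc a)" "c" 1 "(- s)" "(- t)" "plane p (s, t, 1)" 0] assms
    by (simp add: le_imp_power_dvd dvd_mult del: power_Suc)
qed

lemma sublattice_count_line1:
  assumes "p > 0" "c \<le> b" "b \<le> a"
  shows "sublattice_count p (Suc a) (Suc b) (Suc c) (line p (0, 0, 1)) = num_overlattices p a b (Suc c)"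
proof -
  have "line p (0, 0, 1) = range (\<lambda>(x, y, z). (int p ^ 1 * x, int p ^ 1 * y + 0 * x, int p ^ 0 * z + 0 * x + 0 * y))"
  proof (rule eq_range3)
    show "(\<lambda>(x, y, z). (int p ^ 1 * x, int p ^ 1 * y + 0 * x, int p ^ 0 * z + 0 * x + 0 * y)) (x, y, z) \<in> line p (0, 0, 1)" for x y z
      by (auto intro: exI[of _ z])
  next
    fix x y z assume "(x, y, z) \<in> line p (0, 0, 1)"
    then obtain x' y' where "x = int p * x'" "y = int p * y'"
      by (auto elim!: dvdE)
    then show "(x, y, z) \<in> range (\<lambda>(x, y, z). (int p ^ 1 * x, int p ^ 1 * y + 0 * x, int p ^ 0 * z + 0 * x + 0 * y))"
      by (intro image_eqI[of _ _ "(x', y', z)"]) (auto simp: algebra_simps)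
  qed
  then show ?thesis
    using sublattice_count_triangular[of p "b" 1 "0" "a" "(Suc c)" 0 "0" "0" "line p (0, 0, 1)" 1] assms
    by (simp add: le_imp_power_dvd dvd_mult del: power_Suc)
qed

lemma sublattice_count_line2:
  assumes "p > 0" "c \<le> b" "b \<le> a"
  shows "sublattice_count p (Suc a) (Suc b) (Suc c) (line p (0, 1, t)) = num_overlattices p a (Suc b) c"
proof -
  have "line p (0, 1, t) = range (\<lambda>(x, y, z). (int p ^ 1 * x, int p ^ 0 * y + 0 * x, int p ^ 1 * z + 0 * x + t * y))"
  proof (rule eq_range3)
    show "(\<lambda>(x, y, z). (int p ^ 1 * x, int p ^ 0 * y + 0 * x, int p ^ 1 * z + 0 * x + t * y)) (x, y, z) \<in> line p (0, 1, t)" for x y z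
      by (auto intro: exI[of _ y])
  next
    fix x y z assume "(x, y, z) \<in> line p (0, 1, t)"
    then obtain k where k: "int p dvd x" "int p dvd y - k" "int p dvd z - k * t"
      by auto
    have "int p dvd (z - k * t) - (y - k) * t"
      by (rule dvd_diff[OF k(3) dvd_mult2[OF k(2)]])
    then have "int p dvd z - t * y"
      by (simp add: algebra_simps)
    with k(1) obtain x' z' where "x = int p * x'" "z - t * y = int p * z'"
      by (elim dvdE)
    then have "x = int p * x'" "z = int p * z' + t * y"
      by simp_all
    then show "(x, y, z) \<in> range (\<lambda>(x, y, z). (int p ^ 1 * x, int p ^ 0 * y + 0 * x, int p ^ 1 * z + 0 * x + t * y))"
      by (intro image_eqI[of _ _ "(x', y, z')"]) (auto simp: algebra_simps)
  qed
  then show ?thesis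
    using sublattice_count_triangular[of p "(Suc b)" 0 "0" "a" "c" 1 "0" "t" "line p (0, 1, t)" 1] assms
    by (simp add: le_imp_power_dvd dvd_mult del: power_Suc)
qed

text \<open>The first coordinate is the free parameter. The entries s and t send it to coordinates
  with no larger modulus, which is what normalising the first coordinate of d achieves.\<close>

lemma sublattice_count_line3:
  assumes "p > 0" "c \<le> b" "b \<le> a"
  shows "sublattice_count p (Suc a) (Suc b) (Suc c) (line p (1, s, t)) = num_overlattices p (Suc a) b c"
proof -
  have "line p (1, s, t) = range (\<lambda>(x, y, z). (int p ^ 0 * x, int p ^ 1 * y + s * x, int p ^ 1 * z + t * x + 0 * y))"
  proof (rule eq_range3)
    show "(\<lambda>(x, y, z). (int p ^ 0 * x, int p ^ 1 * y + s * x, int p ^ 1 * z + t * x + 0 * y)) (x, y, z) \<in> line p (1, s, t)" for x y z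
      by (auto intro: exI[of _ x])
  next
    fix x y z assume "(x, y, z) \<in> line p (1, s, t)"
    then obtain k where k: "int p dvd x - k" "int p dvd y - k * s" "int p dvd z - k * t"
      by auto
    have "int p dvd (y - k * s) - (x - k) * s" "int p dvd (z - k * t) - (x - k) * t"
      by (rule dvd_diff[OF k(2) dvd_mult2[OF k(1)]], rule dvd_diff[OF k(3) dvd_mult2[OF k(1)]])
    then have "int p dvd y - s * x" "int p dvd z - t * x"
      by (simp_all add: algebra_simps)
    then obtain y' z' where "y - s * x = int p * y'" "z - t * x = int p * z'"
      by (elim dvdE)
    then have "y = int p * y' + s * x" "z = int p * z' + t * x"
      by simp_all
    then show "(x, y, z) \<in> range (\<lambda>(x, y, z). (int p ^ 0 * x, int p ^ 1 * y + s * x, int p ^ 1 * z + t * x + 0 * y))"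
      by (intro image_eqI[of _ _ "(x, y', z')"]) (auto simp: algebra_simps)
  qed
  then show ?thesis
    using sublattice_count_triangular[of p "b" 1 "s" "(Suc a)" "c" 1 "t" "0" "line p (1, s, t)" 0] assms
    by (simp add: le_imp_power_dvd dvd_mult del: power_Suc)
qed

section \<open>Factorizations and generating pairs\<close>

lemma int_card_Collect: "finite S \<Longrightarrow> int (card {x \<in> S. P x}) = (\<Sum>x\<in>S. of_bool (P x))"
  by (simp add: sum_of_bool_eq Collect_conj_eq)

definition generating_pairs :: "nat \<Rightarrow> nat \<Rightarrow> nat \<Rightarrow> nat \<Rightarrow> ((int \<times> int \<times> int) set \<times> (int \<times> int \<times> int) set) set" where
  "generating_pairs p a b c =
     {(L, L'). L \<in> Z3.overlattices (diag_lattice p a b c) \<and> L' \<in> Z3.overlattices (diag_lattice p a b c) \<and> Z3.span (L \<union> L') = UNIV}"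

text \<open>Apply the Moebius identity to J = L + L' and sum over all pairs. A subgroup K contains J
  iff it contains both L and L', so each K contributes the square of its sublattice count.\<close>

lemma card_generating_pairs:
  assumes p: "Factorial_Ring.prime p"
  shows "int (card (generating_pairs p a b c)) = int (num_overlattices p a b c) ^ 2
    - (\<Sum>u\<in>plane_reps p. int (sublattice_count p a b c (plane p u)) ^ 2)
    + int p * (\<Sum>d\<in>line_reps p. int (sublattice_count p a b c (line p d)) ^ 2)
    - int p ^ 3 * int (sublattice_count p a b c (diag_lattice p 1 1 1)) ^ 2"
proof -
  let ?F = "Z3.overlattices (diag_lattice p a b c)"
  let ?in = "\<lambda>K x. of_bool (fst x \<subseteq> K \<and> snd x \<subseteq> K) :: int"
  have fin: "finite ?F"
    by (rule finite_overlattices_diag_lattice[OF prime_gt_0_nat[OF p]])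
  have count: "(\<Sum>x\<in>?F \<times> ?F. ?in K x) = int (sublattice_count p a b c K) ^ 2" for K
  proof -
    have "{x \<in> ?F \<times> ?F. fst x \<subseteq> K \<and> snd x \<subseteq> K} = {L \<in> ?F. L \<subseteq> K} \<times> {L \<in> ?F. L \<subseteq> K}"
      by auto
    then show ?thesis
      using fin int_card_Collect[of "?F \<times> ?F" "\<lambda>x. fst x \<subseteq> K \<and> snd x \<subseteq> K"]
      by (simp add: sublattice_count_def card_cartesian_product power2_eq_square)
  qed
  have pointwise: "of_bool (Z3.span (fst x \<union> snd x) = UNIV)
      = 1 - (\<Sum>u\<in>plane_reps p. ?in (plane p u) x) + int p * (\<Sum>d\<in>line_reps p. ?in (line p d) x)
        - int p ^ 3 * ?in (diag_lattice p 1 1 1) x" if x: "x \<in> ?F \<times> ?F" for x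
  proof -
    let ?J = "Z3.span (fst x \<union> snd x)"
    have sup: "fst x \<union> snd x \<subseteq> ?J" by (rule Z3.span_superset)
    have "?J \<in> ?F"
      using x sup unfolding Z3.overlattices_def by (cases x) (auto intro: order_trans)
    note moebius_identity[OF p this]
    moreover have "?J \<subseteq> K \<longleftrightarrow> fst x \<subseteq> K \<and> snd x \<subseteq> K" if "Z3.subspace K" for K
      using sup Z3.span_minimal[OF _ that, of "fst x \<union> snd x"] by auto
    ultimately show ?thesis
      by (simp add: subspace_plane subspace_line subspace_diag_lattice finite_reps int_card_Collect)
  qed
  have "generating_pairs p a b c = {x \<in> ?F \<times> ?F. Z3.span (fst x \<union> snd x) = UNIV}"
    by (auto simp: generating_pairs_def)
  then have "int (card (generating_pairs p a b c)) = (\<Sum>x\<in>?F \<times> ?F. of_bool (Z3.span (fst x \<union> snd x) = UNIV))"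
    using fin by (simp add: int_card_Collect)
  also have "\<dots> = (\<Sum>x\<in>?F \<times> ?F. 1 - (\<Sum>u\<in>plane_reps p. ?in (plane p u) x)
      + int p * (\<Sum>d\<in>line_reps p. ?in (line p d) x) - int p ^ 3 * ?in (diag_lattice p 1 1 1) x)"
    by (rule sum.cong[OF refl pointwise])
  also have "\<dots> = int (card (?F \<times> ?F)) - (\<Sum>u\<in>plane_reps p. \<Sum>x\<in>?F \<times> ?F. ?in (plane p u) x)
      + int p * (\<Sum>d\<in>line_reps p. \<Sum>x\<in>?F \<times> ?F. ?in (line p d) x)
      - int p ^ 3 * (\<Sum>x\<in>?F \<times> ?F. ?in (diag_lattice p 1 1 1) x)"
    unfolding sum_subtractf sum.distrib sum_distrib_left[symmetric]
      sum.swap[of _ "?F \<times> ?F" "plane_reps p"] sum.swap[of _ "?F \<times> ?F" "line_reps p"] by simp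
  finally show ?thesis
    unfolding count by (simp add: num_overlattices_def card_cartesian_product power2_eq_square)
qed

text \<open>The sublattice count does not depend on the parameters within a family of
  representatives, so the family sizes 1, p and p^2 become the coefficients.\<close>

lemma card_generating_pairs_explicit:
  assumes p: "Factorial_Ring.prime p" and cb: "c \<le> b" and ba: "b \<le> a"
  shows "int (card (generating_pairs p (Suc a) (Suc b) (Suc c))) =
    int (num_overlattices p (Suc a) (Suc b) (Suc c)) ^ 2
    - (int (num_overlattices p a (Suc b) (Suc c)) ^ 2 + int p * int (num_overlattices p (Suc a) b (Suc c)) ^ 2
       + int p ^ 2 * int (num_overlattices p (Suc a) (Suc b) c) ^ 2)
    + int p * (int (num_overlattices p a b (Suc c)) ^ 2 + int p * int (num_overlattices p a (Suc b) c) ^ 2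
       + int p ^ 2 * int (num_overlattices p (Suc a) b c) ^ 2)
    - int p ^ 3 * int (num_overlattices p a b c) ^ 2"
proof -
  have p0: "p > 0" using p by (rule prime_gt_0_nat)
  show ?thesis
    unfolding card_generating_pairs[OF p] sum_plane_reps sum_line_reps
      sublattice_count_plane1[OF p0 cb ba] sublattice_count_plane2[OF p0 cb ba] sublattice_count_plane3[OF p0 cb ba]
      sublattice_count_line1[OF p0 cb ba] sublattice_count_line2[OF p0 cb ba] sublattice_count_line3[OF p0 cb ba]
      sublattice_count_diag_lattice_1[OF p0]
    by (simp add: power2_eq_square power3_eq_cube algebra_simps)
qed

section \<open>Subgroups of the finite group as overlattices\<close>

text \<open>This and the next lemma express both sides as unions over pairs, so that
  \<open>reduce_add\<close> can rewrite the elements in \<open>set_mult_reduce\<close>.\<close>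

lemma set_mult_image: "f ` L <#>\<^bsub>G\<^esub> f ` L' = (\<Union>u\<in>L. \<Union>v\<in>L'. {f u \<otimes>\<^bsub>G\<^esub> f v})"
  by (auto simp: set_mult_def)

lemma image_setcompr_add: "f ` {u + v |u v. u \<in> L \<and> v \<in> L'} = (\<Union>u\<in>L. \<Union>v\<in>L'. {f (u + v)})"
  by auto

abbreviation Zp3 :: "nat \<Rightarrow> nat \<Rightarrow> nat \<Rightarrow> nat \<Rightarrow> (int \<times> int \<times> int) monoid" where
  "Zp3 p a b c \<equiv> integer_mod_group (p ^ a) \<times>\<times> integer_mod_group (p ^ b) \<times>\<times> integer_mod_group (p ^ c)"

text \<open>The quotient map of Z^3 with kernel \<open>diag_lattice\<close>; for p > 0 its values
  are the least nonnegative residues that form the carrier.\<close>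

definition reduce :: "nat \<Rightarrow> nat \<Rightarrow> nat \<Rightarrow> nat \<Rightarrow> int \<times> int \<times> int \<Rightarrow> int \<times> int \<times> int" where
  "reduce p a b c = (\<lambda>(x, y, z). (x mod int p ^ a, y mod int p ^ b, z mod int p ^ c))"

context
  fixes p a b c :: nat
  assumes p0: "p > 0"
begin

interpretation G: group "Zp3 p a b c"
  by (intro DirProd_group group_integer_mod_group)

lemma carrier_Zp3: "carrier (Zp3 p a b c) = {0..<int p ^ a} \<times> {0..<int p ^ b} \<times> {0..<int p ^ c}"
  using p0 by (simp add: carrier_integer_mod_group)

lemma reduce_carrier: "reduce p a b c v \<in> carrier (Zp3 p a b c)"
  unfolding carrier_Zp3 using p0 by (cases v) (simp add: reduce_def)

lemma reduce_of_carrier: "v \<in> carrier (Zp3 p a b c) \<Longrightarrow> reduce p a b c v = v"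
  unfolding carrier_Zp3 by (cases v) (simp add: reduce_def)

lemma reduce_add: "reduce p a b c u \<otimes>\<^bsub>Zp3 p a b c\<^esub> reduce p a b c v = reduce p a b c (u + v)"
  by (cases u; cases v) (simp add: reduce_def mod_simps)

lemma reduce_0: "reduce p a b c 0 = \<one>\<^bsub>Zp3 p a b c\<^esub>"
  by (simp add: reduce_def zero_prod_def)

lemma reduce_uminus: "inv\<^bsub>Zp3 p a b c\<^esub> (reduce p a b c v) = reduce p a b c (- v)"
  by (rule G.inv_equality) (simp_all only: reduce_add reduce_carrier reduce_0 add.left_inverse)

lemma reduce_eq_iff: "reduce p a b c u = reduce p a b c v \<longleftrightarrow> u - v \<in> diag_lattice p a b c"
  by (cases u; cases v) (simp add: reduce_def mod_eq_dvd_iff)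

text \<open>L contains the kernel of \<open>reduce\<close>, so it is a union of its fibres.\<close>

lemma vimage_reduce_image:
  assumes "L \<in> Z3.overlattices (diag_lattice p a b c)"
  shows "reduce p a b c -` (reduce p a b c ` L) = L"
proof (intro equalityI subsetI)
  have L: "Z3.subspace L" "diag_lattice p a b c \<subseteq> L"
    using assms by (auto simp: Z3.overlattices_def)
  fix v assume "v \<in> reduce p a b c -` (reduce p a b c ` L)"
  then obtain w where w: "w \<in> L" "reduce p a b c v = reduce p a b c w" by auto
  then have "v - w \<in> L"
    using L by (auto simp: reduce_eq_iff)
  then show "v \<in> L"
    using Z3.subspace_add[OF L(1), of "v - w" w] w by simp
qed auto

lemma subgroup_reduce_image:
  assumes "L \<in> Z3.overlattices (diag_lattice p a b c)"
  shows "subgroup (reduce p a b c ` L) (Zp3 p a b c)"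
proof (rule G.subgroupI)
  have L: "Z3.subspace L"
    using assms by (auto simp: Z3.overlattices_def)
  show "reduce p a b c ` L \<subseteq> carrier (Zp3 p a b c)"
    by (intro image_subsetI reduce_carrier)
  show "reduce p a b c ` L \<noteq> {}"
    using Z3.subspace_0[OF L] by auto
  show "inv\<^bsub>Zp3 p a b c\<^esub> x \<in> reduce p a b c ` L" if "x \<in> reduce p a b c ` L" for x
    using that Z3.subspace_neg[OF L] by (auto simp only: reduce_uminus)
  show "x \<otimes>\<^bsub>Zp3 p a b c\<^esub> y \<in> reduce p a b c ` L"
    if "x \<in> reduce p a b c ` L" "y \<in> reduce p a b c ` L" for x y
    using that Z3.subspace_add[OF L] by (auto simp only: reduce_add)
qed

lemma overlattice_reduce_vimage:
  assumes H: "subgroup H (Zp3 p a b c)"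
  shows "reduce p a b c -` H \<in> Z3.overlattices (diag_lattice p a b c)"
proof -
  have "Z3.subspace (reduce p a b c -` H)"
  proof (rule Z3.subspaceI_diff)
    show "0 \<in> reduce p a b c -` H"
      using subgroup.one_closed[OF H] reduce_0 by simp
    fix u v assume "u \<in> reduce p a b c -` H" "v \<in> reduce p a b c -` H"
    then have "reduce p a b c u \<otimes>\<^bsub>Zp3 p a b c\<^esub> inv\<^bsub>Zp3 p a b c\<^esub> (reduce p a b c v) \<in> H"
      using subgroup.m_closed[OF H] subgroup.m_inv_closed[OF H] by blast
    then show "u - v \<in> reduce p a b c -` H"
      unfolding reduce_uminus reduce_add by simp
  qed
  moreover have "reduce p a b c v = \<one>\<^bsub>Zp3 p a b c\<^esub>" if "v \<in> diag_lattice p a b c" for v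
    using that reduce_eq_iff[of v 0] unfolding reduce_0 by simp
  ultimately show ?thesis
    using subgroup.one_closed[OF H] by (auto simp only: Z3.overlattices_def mem_Collect_eq vimage_eq)
qed

lemma reduce_image_vimage:
  assumes H: "subgroup H (Zp3 p a b c)"
  shows "reduce p a b c ` (reduce p a b c -` H) = H"
proof (intro equalityI subsetI)
  fix x assume "x \<in> H"
  then have "reduce p a b c x = x"
    using subgroup.subset[OF H] by (intro reduce_of_carrier) auto
  then show "x \<in> reduce p a b c ` (reduce p a b c -` H)"
    using \<open>x \<in> H\<close> by (intro image_eqI[of _ _ x]) auto
qed auto

lemma set_mult_reduce:
  assumes "Z3.subspace L" "Z3.subspace L'"
  shows "reduce p a b c ` L <#>\<^bsub>Zp3 p a b c\<^esub> reduce p a b c ` L' = reduce p a b c ` Z3.span (L \<union> L')"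
  unfolding set_mult_image reduce_add Z3.span_Un Z3.span_eq_iff[THEN iffD2, OF assms(1)]
    Z3.span_eq_iff[THEN iffD2, OF assms(2)] image_setcompr_add ..

lemma reduce_image_eq_carrier_iff:
  assumes "L \<in> Z3.overlattices (diag_lattice p a b c)"
  shows "carrier (Zp3 p a b c) = reduce p a b c ` L \<longleftrightarrow> L = UNIV"
proof -
  have vimage_carrier: "reduce p a b c -` carrier (Zp3 p a b c) = UNIV"
    using reduce_carrier by (intro equalityI subsetI vimageI2 UNIV_I)
  show ?thesis
  proof
    assume "carrier (Zp3 p a b c) = reduce p a b c ` L"
    then show "L = UNIV"
      using vimage_reduce_image[OF assms] vimage_carrier by argo
  next
    assume "L = UNIV"
    then show "carrier (Zp3 p a b c) = reduce p a b c ` L"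
      using reduce_image_vimage[OF G.subgroup_self] vimage_carrier by argo
  qed
qed

text \<open>Images and preimages under \<open>reduce\<close> are mutually inverse on overlattices
  and subgroups. A product of subgroups corresponds to the sum of the lattices, and the whole group
  to Z^3.\<close>

lemma factorization_number_eq: "factorization_number (Zp3 p a b c) = card (generating_pairs p a b c)"
proof -
  let ?r = "reduce p a b c"
  have factor_iff: "carrier (Zp3 p a b c) = ?r ` L <#>\<^bsub>Zp3 p a b c\<^esub> ?r ` L' \<longleftrightarrow> Z3.span (L \<union> L') = UNIV"
    if "L \<in> Z3.overlattices (diag_lattice p a b c)" "L' \<in> Z3.overlattices (diag_lattice p a b c)" for L L'
  proof -
    have "L \<union> L' \<subseteq> Z3.span (L \<union> L')" by (rule Z3.span_superset)
    then have "Z3.span (L \<union> L') \<in> Z3.overlattices (diag_lattice p a b c)"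
      using that by (auto simp: Z3.overlattices_def)
    then show ?thesis
      using that reduce_image_eq_carrier_iff set_mult_reduce[of L L'] by (simp add: Z3.overlattices_def)
  qed
  have "bij_betw (map_prod ((`) ?r) ((`) ?r)) (generating_pairs p a b c) (factorizations (Zp3 p a b c))"
  proof (rule bij_betwI[where g = "map_prod ((-`) ?r) ((-`) ?r)"])
    show "map_prod ((`) ?r) ((`) ?r) \<in> generating_pairs p a b c \<rightarrow> factorizations (Zp3 p a b c)"
    proof
      fix x assume "x \<in> generating_pairs p a b c"
      then obtain L L' where L: "x = (L, L')" "L \<in> Z3.overlattices (diag_lattice p a b c)"
        "L' \<in> Z3.overlattices (diag_lattice p a b c)" "Z3.span (L \<union> L') = UNIV"
        unfolding generating_pairs_def by blast
      then show "map_prod ((`) ?r) ((`) ?r) x \<in> factorizations (Zp3 p a b c)"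
        unfolding factorizations_def L(1) map_prod_simp mem_Collect_eq case_prod_conv
        using factor_iff[OF L(2,3)] subgroup_reduce_image by blast
    qed
    show "map_prod ((-`) ?r) ((-`) ?r) \<in> factorizations (Zp3 p a b c) \<rightarrow> generating_pairs p a b c"
    proof
      fix x assume "x \<in> factorizations (Zp3 p a b c)"
      then obtain H K where HK: "x = (H, K)" "subgroup H (Zp3 p a b c)" "subgroup K (Zp3 p a b c)"
        "carrier (Zp3 p a b c) = H <#>\<^bsub>Zp3 p a b c\<^esub> K"
        unfolding factorizations_def by blast
      then show "map_prod ((-`) ?r) ((-`) ?r) x \<in> generating_pairs p a b c"
        using factor_iff[OF overlattice_reduce_vimage[OF HK(2)] overlattice_reduce_vimage[OF HK(3)]]
          overlattice_reduce_vimage reduce_image_vimage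
        by (simp add: generating_pairs_def)
    qed
  next
    fix x assume "x \<in> generating_pairs p a b c"
    then show "map_prod ((-`) ?r) ((-`) ?r) (map_prod ((`) ?r) ((`) ?r) x) = x"
      unfolding generating_pairs_def using vimage_reduce_image by (cases x) simp
  next
    fix x assume "x \<in> factorizations (Zp3 p a b c)"
    then show "map_prod ((`) ?r) ((`) ?r) (map_prod ((-`) ?r) ((-`) ?r) x) = x"
      unfolding factorizations_def using reduce_image_vimage
      by (cases x) (simp only: map_prod_simp mem_Collect_eq case_prod_conv)
  qed
  then show ?thesis
    unfolding factorization_number_def by (metis bij_betw_same_card)
qed

end

theorem theorem3:
  fixes p l1 l2 l3 :: nat
  assumes "Factorial_Ring.prime p"
    and "l1 \<ge> l2" and "l2 \<ge> l3" and "l3 \<ge> 1"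
  shows "real (factorization_number
           (integer_mod_group (p ^ l1) \<times>\<times> integer_mod_group (p ^ l2) \<times>\<times> integer_mod_group (p ^ l3))) =
         - (real p ^ 3) * (f_expr p (l1 - 1) (l2 - 1) (l3 - 1))\<^sup>2
         + real p * ((f_expr p (l1 - 1) (l2 - 1) l3)\<^sup>2
                     + real p * (f_expr p (l1 - 1) l2 (l3 - 1))\<^sup>2
                     + real p ^ 2 * (f_expr p l1 (l2 - 1) (l3 - 1))\<^sup>2)
         - ((f_expr p (l1 - 1) l2 l3)\<^sup>2
            + real p * (f_expr p l1 (l2 - 1) l3)\<^sup>2
            + real p ^ 2 * (f_expr p l1 l2 (l3 - 1))\<^sup>2)
         + (f_expr p l1 l2 l3)\<^sup>2"
proof -
  \<comment> \<open>As all exponents are positive, the truncated subtractions in the formula are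
    genuine.\<close>
  obtain a b c where abc: "l1 = Suc a" "l2 = Suc b" "l3 = Suc c" "c \<le> b" "b \<le> a"
    using assms by (cases l1; cases l2; cases l3) auto
  have "real (factorization_number (Zp3 p l1 l2 l3)) = real_of_int (int (card (generating_pairs p (Suc a) (Suc b) (Suc c))))"
    unfolding abc(1-3) factorization_number_eq[OF prime_gt_0_nat[OF assms(1)]] by simp
  then show ?thesis
    unfolding card_generating_pairs_explicit[OF assms(1) abc(4,5)]
    \<comment> \<open>Each argument triple of \<open>f_expr\<close> is out of order by at most one,
      as \<open>f_expr_eq_num_overlattices\<close> allows.\<close>
    using abc(4,5) by (simp add: abc(1-3) f_expr_eq_num_overlattices[OF assms(1)])
qed

end
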